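(* Let $S,T\in\mathcal{L}(\mathcal{H})$ be selfadjoint operators with closed range, with positive orthogonal decompositions $S=S^+-S^-$ and $T=T^+-T^-$. If $S\leq T$ and $T^\dagger\leq S^\dagger$, then $$\mathcal{R}\bigl((T^++S^-)^{1/2}\bigr)=\mathcal{R}\bigl((S^++T^-)^{1/2}\bigr)=\mathcal{R}(S)+\mathcal{R}(T),$$ or equivalently, $$\mathcal{R}(T^+)+\mathcal{R}(S^-)=\mathcal{R}(S^+)+\mathcal{R}(T^-)=\mathcal{R}(S)+\mathcal{R}(T).$$ If, in addition, $\mathcal{N}(T)\subseteq\mathcal{N}(S^-)$ and $\mathcal{N}(S)\subseteq\mathcal{N}(T^-)$, then $\mathcal{R}(S)=\mathcal{R}(T)$.
   Context: $\mathcal{H}$ is a complex Hilbert space and $\mathcal{L}(\mathcal{H})$ is the algebra of bounded linear operators on $\mathcal{H}$. $\mathcal{R}(A)$ and $\mathcal{N}(A)$ denote the range and nullspace of $A$. For selfadjoint $A,B$, $A\leq B$ (Löwner order) means $\langle Ax,x\rangle\leq\langle Bx,x\rangle$ for all $x\in\mathcal{H}$. The positive orthogonal decomposition of a selfadjoint $A\in\mathcal{L}(\mathcal{H})$ is $A=A^+-A^-$ with $A^+=\frac{|A|+A}{2}$, $A^-=\frac{|A|-A}{2}$, where $|A|=(A^*A)^{1/2}$. For $A\in\mathcal{L}(\mathcal{H})$ with closed range, $A^\dagger\in\mathcal{L}(\mathcal{H})$ is the Moore-Penrose inverse, the unique $X\in\mathcal{L}(\mathcal{H})$ with $AXA=A$,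 $XAX=X$, $AX=P_{\mathcal{R}(A)}$, $XA=P_{\mathcal{R}(A^* )}$, where $P_{\mathcal{V}}$ denotes the orthogonal projection onto the closed subspace $\mathcal{V}$. The sum of two subspaces is the algebraic sum (no closure taken). *)

theory Defs
  imports "HOL-Analysis.Analysis" "HOL-Library.Set_Algebras"
begin

text \<open>
  The library has real inner product spaces only. A complex Hilbert space is a complete
  real inner product space with a compatible complex scalar multiplication and a sesquilinear
  form \<open>cinner\<close>, linear in the first argument, whose real part is the real inner product
  (so \<open>norm x = sqrt (Re (cinner x x))\<close>). The zero space is included.
\<close>

class complex_hilbert_space = real_inner + complete_space +
  fixes scaleC :: "complex \<Rightarrow> 'a \<Rightarrow> 'a"  (infixr \<open>*\<^sub>C\<close> 75)
    and cinner :: "'a \<Rightarrow> 'a \<Rightarrow> complex"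
  assumes scaleC_add_right: "c *\<^sub>C (x + y) = c *\<^sub>C x + c *\<^sub>C y"
    and scaleC_add_left: "(c + d) *\<^sub>C x = c *\<^sub>C x + d *\<^sub>C x"
    and scaleC_scaleC: "c *\<^sub>C d *\<^sub>C x = (c * d) *\<^sub>C x"
    and scaleC_of_real: "complex_of_real r *\<^sub>C x = r *\<^sub>R x"
    and cinner_add_left: "cinner (x + y) z = cinner x z + cinner y z"
    and cinner_scaleC_left: "cinner (c *\<^sub>C x) y = c * cinner x y"
    and cinner_commute: "cinner y x = cnj (cinner x y)"
    and Re_cinner: "Re (cinner x y) = inner x y"

definition bounded_clinear :: "('a::complex_hilbert_space \<Rightarrow> 'a) \<Rightarrow> bool" where
  "bounded_clinear A \<longleftrightarrow> bounded_linear A \<and> (\<forall>c x. A (c *\<^sub>C x) = c *\<^sub>C A x)"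

definition cadjoint :: "('a::complex_hilbert_space \<Rightarrow> 'a) \<Rightarrow> 'a \<Rightarrow> 'a" where
  "cadjoint A = (THE B. bounded_clinear B \<and> (\<forall>x y. cinner (A x) y = cinner x (B y)))"

definition selfadjoint :: "('a::complex_hilbert_space \<Rightarrow> 'a) \<Rightarrow> bool" where
  "selfadjoint A \<longleftrightarrow> cadjoint A = A"

text \<open>
  The order is only meant for selfadjoint operators, whose quadratic forms are real;
  there \<open>Re\<close> discards nothing.
\<close>

definition loewner_le :: "('a::complex_hilbert_space \<Rightarrow> 'a) \<Rightarrow> ('a \<Rightarrow> 'a) \<Rightarrow> bool"
    (infix \<open>\<le>\<^sub>L\<close> 50) where
  "A \<le>\<^sub>L B \<longleftrightarrow> (\<forall>x. Re (cinner (A x) x) \<le> Re (cinner (B x) x))"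

definition positive_op :: "('a::complex_hilbert_space \<Rightarrow> 'a) \<Rightarrow> bool" where
  "positive_op A \<longleftrightarrow> bounded_clinear A \<and> selfadjoint A \<and> (\<lambda>x. 0) \<le>\<^sub>L A"

text \<open>The positive square root; meaningful for positive operators.\<close>

definition sqrt_op :: "('a::complex_hilbert_space \<Rightarrow> 'a) \<Rightarrow> 'a \<Rightarrow> 'a" where
  "sqrt_op A = (THE B. positive_op B \<and> B \<circ> B = A)"

definition abs_op :: "('a::complex_hilbert_space \<Rightarrow> 'a) \<Rightarrow> 'a \<Rightarrow> 'a" where
  "abs_op A = sqrt_op (cadjoint A \<circ> A)"

definition pos_part :: "('a::complex_hilbert_space \<Rightarrow> 'a) \<Rightarrow> 'a \<Rightarrow> 'a" where
  "pos_part A = (\<lambda>x. (abs_op A x + A x) /\<^sub>R 2)"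

definition neg_part :: "('a::complex_hilbert_space \<Rightarrow> 'a) \<Rightarrow> 'a \<Rightarrow> 'a" where
  "neg_part A = (\<lambda>x. (abs_op A x - A x) /\<^sub>R 2)"

text \<open>Meaningful when \<open>V\<close> is a closed complex subspace.\<close>

definition orth_proj :: "'a::complex_hilbert_space set \<Rightarrow> 'a \<Rightarrow> 'a" where
  "orth_proj V x = (THE p. p \<in> V \<and> (\<forall>v\<in>V. cinner (x - p) v = 0))"

text \<open>Meaningful when \<open>A\<close> is a bounded operator with closed range.\<close>

definition mp_inverse :: "('a::complex_hilbert_space \<Rightarrow> 'a) \<Rightarrow> 'a \<Rightarrow> 'a" where
  "mp_inverse A = (THE X. bounded_clinear X \<and>
     A \<circ> X \<circ> A = A \<and> X \<circ> A \<circ> X = X \<and>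
     A \<circ> X = orth_proj (range A) \<and> X \<circ> A = orth_proj (range (cadjoint A)))"

definition nullspace :: "('a::complex_hilbert_space \<Rightarrow> 'a) \<Rightarrow> 'a set" where
  "nullspace A = {x. A x = 0}"

end

theory Submission
  imports Defs
begin

text \<open>
  For a nonnegative operator \<open>A\<close>, the range of \<open>A\<^sup>1\<^sup>/\<^sup>2\<close> consists of the vectors \<open>z\<close> whose functional
  \<open>x \<mapsto> \<langle>z, x\<rangle>\<close> satisfies \<open>\<langle>z, x\<rangle>\<^sup>2 \<le> k \<langle>A x, x\<rangle>\<close> for some \<open>k\<close> (Douglas). This set grows with the
  quadratic form of \<open>A\<close>, turns sums of operators into sums of subspaces, and is the range of \<open>A\<close>
  when that range is closed. Rewriting \<open>S \<le> T\<close> as \<open>S\<^sup>+ + T\<^sup>- \<le> T\<^sup>+ + S\<^sup>-\<close> gives one inclusion of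
  ranges. With \<open>X\<close> the Moore-Penrose inverse of \<open>T\<close>, \<open>X = X T\<^sup>+ X - X T\<^sup>- X\<close> is again a difference
  of nonnegative operators with the same ranges as \<open>T\<^sup>+\<close> and \<open>T\<^sup>-\<close>, so the order relation between
  the Moore-Penrose inverses gives the reverse inclusion.

  A complex-linear operator is adjoint to another with respect to \<open>cinner\<close> if and only if it is
  with respect to the real form \<open>inner\<close>; the operator theory can therefore be done over the reals,
  complex linearity of square roots and inverses coming from their commuting with \<open>scaleC c\<close>.
\<close>

section \<open>Orthogonal projection and Riesz representation\<close>

instance complex_hilbert_space \<subseteq> banach ..

text \<open>A minimising sequence for the distance to \<open>V\<close> is Cauchy by the
  parallelogram identity, since midpoints stay in \<open>V\<close>. Its limit is a closest point,
  and moving along \<open>V\<close> cannot shorten the residual.\<close>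

lemma orthogonal_projection_exists:
  fixes V :: "'a::{real_inner,banach} set"
  assumes V: "subspace V" "closed V"
  obtains p where "p \<in> V" "\<And>v. v \<in> V \<Longrightarrow> inner (x - p) v = 0"
proof -
  define D where "D = (\<lambda>v. (norm (x - v))\<^sup>2) ` V"
  define d where "d = Inf D"
  have "0 \<in> V" using V(1) by (rule subspace_0)
  then have ne: "D \<noteq> {}" by (auto simp: D_def)
  have bdd: "bdd_below D" by (rule bdd_belowI[of _ 0]) (auto simp: D_def)
  have d_le: "d \<le> (norm (x - v))\<^sup>2" if "v \<in> V" for v
    unfolding d_def using that bdd by (intro cInf_lower) (auto simp: D_def)
  have "\<exists>v\<in>V. (norm (x - v))\<^sup>2 < d + inverse (real (Suc n))" for n
  proof -
    have "Inf D < d + inverse (real (Suc n))" by (simp add: d_def)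
    then show ?thesis using cInf_lessD[OF ne] by (force simp: D_def)
  qed
  then obtain w where wV: "\<And>n. w n \<in> V"
    and w: "\<And>n. (norm (x - w n))\<^sup>2 < d + inverse (real (Suc n))"
    by metis
  have close: "(norm (w m - w n))\<^sup>2 \<le> 2 * inverse (real (Suc m)) + 2 * inverse (real (Suc n))" for m n
  proof -
    have "(1/2) *\<^sub>R (w m + w n) \<in> V" using V(1) wV by (simp add: subspace_add subspace_scale)
    from d_le[OF this] have "4 * d \<le> 4 * (norm (x - (1/2) *\<^sub>R (w m + w n)))\<^sup>2" by simp
    moreover have "(norm (w m - w n))\<^sup>2 = 2 * (norm (x - w m))\<^sup>2 + 2 * (norm (x - w n))\<^sup>2
        - 4 * (norm (x - (1/2) *\<^sub>R (w m + w n)))\<^sup>2"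
      unfolding power2_norm_eq_inner
      by (simp add: inner_diff_left inner_diff_right inner_add_left inner_add_right inner_commute
          algebra_simps)
    ultimately show ?thesis using w[of m] w[of n] by linarith
  qed
  have "Cauchy w"
  proof (rule metric_CauchyI)
    fix e :: real assume "0 < e"
    then obtain N where N: "inverse (real (Suc N)) < e\<^sup>2 / 4"
      using reals_Archimedean[of "e\<^sup>2 / 4"] by auto
    show "\<exists>M. \<forall>m\<ge>M. \<forall>n\<ge>M. dist (w m) (w n) < e"
    proof (intro exI allI impI)
      fix m n assume "N \<le> m" "N \<le> n"
      then have "inverse (real (Suc m)) \<le> inverse (real (Suc N))"
        "inverse (real (Suc n)) \<le> inverse (real (Suc N))" by auto
      with close[of m n] N have "(norm (w m - w n))\<^sup>2 < e\<^sup>2" by linarith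
      then show "dist (w m) (w n) < e"
        using \<open>0 < e\<close> by (simp add: dist_norm power2_less_imp_less)
    qed
  qed
  then obtain p where p: "w \<longlonglongrightarrow> p" using Cauchy_convergent convergent_def by blast
  have pV: "p \<in> V" using V(2) wV p by (meson closed_sequentially)
  have "(\<lambda>n. (norm (x - w n))\<^sup>2) \<longlonglongrightarrow> (norm (x - p))\<^sup>2" by (intro tendsto_intros p)
  moreover have "(\<lambda>n. d + inverse (real (Suc n))) \<longlonglongrightarrow> d + 0"
    by (intro tendsto_intros LIMSEQ_inverse_real_of_nat)
  ultimately have pd: "(norm (x - p))\<^sup>2 \<le> d"
    using LIMSEQ_le[of "\<lambda>n. (norm (x - w n))\<^sup>2" _ "\<lambda>n. d + inverse (real (Suc n))" "d + 0"]
      less_imp_le[OF w] by auto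
  have "inner (x - p) v = 0" if v: "v \<in> V" for v
  proof (cases "v = 0")
    case False
    \<comment> \<open>This value minimises the squared norm of x - (p + t v) as a polynomial in
      t.\<close>
    define t where "t = inner (x - p) v / inner v v"
    have "p + t *\<^sub>R v \<in> V" using V(1) pV v by (simp add: subspace_add subspace_scale)
    from d_le[OF this] pd have "(norm (x - p))\<^sup>2 \<le> (norm (x - (p + t *\<^sub>R v)))\<^sup>2"
      by linarith
    also have "\<dots> = (norm (x - p))\<^sup>2 - 2 * t * inner (x - p) v + t * t * inner v v"
      unfolding power2_norm_eq_inner
      by (simp add: inner_diff_left inner_diff_right inner_add_left inner_add_right inner_commute
          algebra_simps)
    also have "t * t * inner v v = t * inner (x - p) v" using False by (simp add: t_def)
    finally have "t * inner (x - p) v \<le> 0" by simp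
    then have "(inner (x - p) v)\<^sup>2 / inner v v \<le> 0"
      by (simp add: t_def power2_eq_square)
    moreover have "0 < inner v v" using False by simp
    ultimately show ?thesis by (simp add: divide_le_0_iff)
  qed simp
  with pV show thesis using that by blast
qed

text \<open>The residual \<open>w\<close> of a vector outside the kernel is orthogonal to the
  kernel, and every \<open>x\<close> differs from a multiple of \<open>w\<close> by a kernel
  element.\<close>

lemma riesz_representation:
  fixes f :: "'a::{real_inner,banach} \<Rightarrow> real"
  assumes f: "bounded_linear f"
  obtains y where "\<And>x. f x = inner x y"
proof (cases "\<forall>x. f x = 0")
  case True
  then show thesis using that[of 0] by simp
next
  case False
  interpret f: bounded_linear f by (rule f)
  from False obtain a where a: "f a \<noteq> 0" by blast
  have "subspace {x. f x = 0}" by (auto simp: subspace_def f.add f.scaleR f.zero)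
  moreover have "closed {x. f x = 0}"
    by (intro closed_Collect_eq continuous_intros f.continuous_on)
  ultimately obtain p where p: "f p = 0" and orth: "\<And>v. f v = 0 \<Longrightarrow> inner (a - p) v = 0"
    using orthogonal_projection_exists[of "{x. f x = 0}" a] by auto
  define w where "w = a - p"
  have fw: "f w \<noteq> 0" using a p by (simp add: w_def f.diff)
  then have w: "inner w w \<noteq> 0" by (auto simp: f.zero)
  have "f x = inner x ((f w / inner w w) *\<^sub>R w)" for x
  proof -
    have "f (x - (f x / f w) *\<^sub>R w) = 0" using fw by (simp add: f.diff f.scaleR)
    then have "inner w (x - (f x / f w) *\<^sub>R w) = 0" unfolding w_def by (rule orth)
    then have "inner w x = (f x / f w) * inner w w" by (simp add: inner_diff_right)
    then show ?thesis using fw w by (simp add: inner_commute)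
  qed
  then show thesis by (rule that)
qed

section \<open>Ranges of adjoint operators\<close>

lemma subspace_closure:
  fixes V :: "'a::real_normed_vector set"
  assumes V: "subspace V"
  shows "subspace (closure V)"
proof (rule subspaceI)
  show "0 \<in> closure V" using subspace_0[OF V] closure_subset by blast
next
  fix x y assume "x \<in> closure V" "y \<in> closure V"
  then obtain f g where "\<And>n. f n \<in> V" "f \<longlonglongrightarrow> x" "\<And>n. g n \<in> V" "g \<longlonglongrightarrow> y"
    by (auto simp: closure_sequential)
  then show "x + y \<in> closure V"
    unfolding closure_sequential
    by (intro exI[of _ "\<lambda>n. f n + g n"]) (auto intro: tendsto_add subspace_add[OF V])
next
  fix x and c :: real assume "x \<in> closure V"
  then obtain f where "\<And>n. f n \<in> V" "f \<longlonglongrightarrow> x" by (auto simp: closure_sequential)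
  then show "c *\<^sub>R x \<in> closure V"
    unfolding closure_sequential
    by (intro exI[of _ "\<lambda>n. c *\<^sub>R f n"]) (auto intro: tendsto_scaleR subspace_scale[OF V])
qed

text \<open>
  Projecting \<open>(0, 1)\<close> onto the closure of the graph-like subspace of all \<open>(L x, \<langle>z, x\<rangle>)\<close>
  plays the role of extending the functional \<open>L x \<mapsto> \<langle>z, x\<rangle>\<close> from the range of \<open>L\<close>.
\<close>

lemma range_adjoint_iff:
  fixes L :: "'a::{real_inner,banach} \<Rightarrow> 'b::{real_inner,banach}"
  assumes L: "bounded_linear L" and M: "linear M"
    and adj: "\<And>x y. inner (L x) y = inner x (M y)"
  shows "z \<in> range M \<longleftrightarrow> (\<exists>c. \<forall>x. \<bar>inner z x\<bar> \<le> c * norm (L x))"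
proof
  assume "z \<in> range M"
  then obtain y where y: "z = M y" by blast
  have "\<bar>inner z x\<bar> \<le> norm y * norm (L x)" for x
    using Cauchy_Schwarz_ineq2[of "L x" y] by (simp add: y adj inner_commute[of "M y"] mult.commute)
  then show "\<exists>c. \<forall>x. \<bar>inner z x\<bar> \<le> c * norm (L x)" by blast
next
  interpret L: bounded_linear L by (rule L)
  assume "\<exists>c. \<forall>x. \<bar>inner z x\<bar> \<le> c * norm (L x)"
  then obtain c where c: "\<And>x. \<bar>inner z x\<bar> \<le> c * norm (L x)" by blast
  define G where "G = range (\<lambda>x. (L x, inner z x))"
  have "linear (\<lambda>x. (L x, inner z x))"
    by (auto intro!: linearI simp: L.add L.scaleR inner_add_right)
  then have "subspace G" unfolding G_def by (intro linear_subspace_image) auto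
  then have G: "subspace (closure G)" by (rule subspace_closure)
  have "G \<subseteq> {h. \<bar>snd h\<bar> \<le> c * norm (fst h)}" using c by (auto simp: G_def)
  moreover have "closed {h :: 'b \<times> real. \<bar>snd h\<bar> \<le> c * norm (fst h)}"
    by (intro closed_Collect_le continuous_intros)
  ultimately have bound: "\<And>h. h \<in> closure G \<Longrightarrow> \<bar>snd h\<bar> \<le> c * norm (fst h)"
    using closure_minimal by blast
  obtain p where p: "p \<in> closure G" and orth: "\<And>v. v \<in> closure G \<Longrightarrow> inner ((0, 1) - p) v = 0"
    using orthogonal_projection_exists[OF G closed_closure, of "(0, 1)"] by blast
  \<comment> \<open>\<open>(a, b)\<close> is the residual \<open>(0, 1) - p\<close>. Its
    orthogonality to \<open>G\<close> expresses \<open>inner z x\<close> through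
    \<open>inner a (L x)\<close> as soon as \<open>b\<close> is nonzero.\<close>
  define a b where "a = - fst p" and "b = 1 - snd p"
  have ab: "inner a (L x) + b * inner z x = 0" for x
    using orth[of "(L x, inner z x)"] closure_subset[of G]
    by (auto simp: G_def inner_prod_def a_def b_def)
  have "inner a a = b * (1 - b)"
    using orth[OF p] by (auto simp: inner_prod_def a_def b_def algebra_simps)
  \<comment> \<open>If \<open>b\<close> were 0, then \<open>a = 0\<close> and
    \<open>p = (0, 1)\<close>, which contradicts the bound on the closure.\<close>
  then have "b \<noteq> 0" using bound[OF p] by (auto simp: a_def b_def)
  have "inner (M ((- (1 / b)) *\<^sub>R a)) x = - (1 / b) * inner a (L x)" for x
    using adj[of x "(- (1 / b)) *\<^sub>R a"] by (simp add: inner_commute)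
  moreover have "- (1 / b) * inner a (L x) = inner z x" for x
  proof -
    have "inner a (L x) = - (b * inner z x)" using ab[of x] by linarith
    then show ?thesis using \<open>b \<noteq> 0\<close> by simp
  qed
  ultimately have "inner z x = inner (M ((- (1 / b)) *\<^sub>R a)) x" for x by simp
  then have "z = M ((- (1 / b)) *\<^sub>R a)" by (metis vector_eq_rdot)
  then show "z \<in> range M" by blast
qed

section \<open>Symmetric and nonnegative operators over the reals\<close>

definition symmetric_op :: "('a::real_inner \<Rightarrow> 'a) \<Rightarrow> bool" where
  "symmetric_op A \<longleftrightarrow> bounded_linear A \<and> (\<forall>x y. inner (A x) y = inner x (A y))"

definition nonneg_op :: "('a::real_inner \<Rightarrow> 'a) \<Rightarrow> bool" where
  "nonneg_op A \<longleftrightarrow> symmetric_op A \<and> (\<forall>x. 0 \<le> inner (A x) x)"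

lemma symmetric_opI:
  "bounded_linear A \<Longrightarrow> (\<And>x y. inner (A x) y = inner x (A y)) \<Longrightarrow> symmetric_op A"
  by (simp add: symmetric_op_def)

lemma symmetric_opD:
  assumes "symmetric_op A"
  shows "bounded_linear A" and "inner (A x) y = inner x (A y)"
  using assms by (auto simp: symmetric_op_def)

lemma nonneg_opI:
  "symmetric_op A \<Longrightarrow> (\<And>x. 0 \<le> inner (A x) x) \<Longrightarrow> nonneg_op A"
  by (simp add: nonneg_op_def)

lemma nonneg_opD:
  assumes "nonneg_op A"
  shows "symmetric_op A" and "0 \<le> inner (A x) x"
  using assms by (auto simp: nonneg_op_def)

lemma linear_simps_op:
  assumes "bounded_linear A"
  shows "A (x + y) = A x + A y" "A (x - y) = A x - A y" "A (c *\<^sub>R x) = c *\<^sub>R A x"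
    "A 0 = 0" "A (- x) = - A x"
  using assms
  by (simp_all add: linear_simps)

lemma symmetric_op_add:
  assumes "symmetric_op A" "symmetric_op B"
  shows "symmetric_op (\<lambda>x. A x + B x)"
  using assms by (auto simp: symmetric_op_def inner_add_left inner_add_right bounded_linear_add)

lemma symmetric_op_diff:
  assumes "symmetric_op A" "symmetric_op B"
  shows "symmetric_op (\<lambda>x. A x - B x)"
  using assms by (auto simp: symmetric_op_def inner_diff_left inner_diff_right bounded_linear_sub)

lemma symmetric_op_scaleR:
  assumes "symmetric_op A"
  shows "symmetric_op (\<lambda>x. c *\<^sub>R A x)"
  using assms by (auto simp: symmetric_op_def bounded_linear_scaleR_right
      bounded_linear_compose[OF bounded_linear_scaleR_right])

lemma nonneg_op_add:
  assumes "nonneg_op A" "nonneg_op B"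
  shows "nonneg_op (\<lambda>x. A x + B x)"
  using assms by (auto simp: nonneg_op_def symmetric_op_add inner_add_left)

lemma nonneg_op_scaleR:
  assumes "nonneg_op A" "0 \<le> c"
  shows "nonneg_op (\<lambda>x. c *\<^sub>R A x)"
  using assms by (auto simp: nonneg_op_def symmetric_op_scaleR)

section \<open>Square roots of nonnegative operators\<close>

text \<open>\<open>C - C\<^sup>2 = (1 - C) C (1 - C) + C (1 - C) C\<close> is nonnegative when \<open>0 \<le> C \<le> 1\<close>.\<close>

lemma norm_le_of_le_identity:
  assumes C: "nonneg_op C" and le: "\<And>x. inner (C x) x \<le> inner x x"
  shows "norm (C x) \<le> norm x"
proof -
  note lin = linear_simps_op[OF symmetric_opD(1)[OF nonneg_opD(1)[OF C]]]
  note sym = symmetric_opD(2)[OF nonneg_opD(1)[OF C]]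
  have "0 \<le> inner (C (x - C x)) (x - C x)" using C by (rule nonneg_opD)
  moreover have "inner (C (C x)) (C x) \<le> inner (C x) (C x)" by (rule le)
  ultimately have "inner (C x) (C x) \<le> inner (C x) x"
    by (simp add: lin inner_diff_left inner_diff_right inner_commute[of "C x" x]
        sym[of "C x" x] sym[of x "C x"])
  also have "\<dots> \<le> inner x x" by (rule le)
  finally show ?thesis by (simp add: norm_le)
qed

text \<open>The equation for \<open>L\<close> says that 1 - L is a square root of 1 - C. It is
  solved by iterating X to (C + X^2)/2 from 0. The iterates are polynomials in \<open>C\<close>, so
  the limit is symmetric and commutes with whatever commutes with \<open>C\<close>.\<close>

lemma quadratic_fixed_point_exists:
  fixes C :: "'a::{real_inner,banach} \<Rightarrow> 'a"
  assumes C: "symmetric_op C" and contr: "\<And>x. norm (C x) \<le> norm x"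
  obtains L where "symmetric_op L" "\<And>x. norm (L x) \<le> norm x"
    "\<And>x. 2 *\<^sub>R L x = C x + L (L x)"
    "\<forall>D. bounded_linear D \<longrightarrow> (\<forall>x. D (C x) = C (D x)) \<longrightarrow> (\<forall>x. D (L x) = L (D x))"
proof -
  have blC: "bounded_linear C" using C by (rule symmetric_opD)
  define K where "K = Blinfun C"
  have K: "blinfun_apply K = C" unfolding K_def by (rule bounded_linear_Blinfun_apply[OF blC])
  have nK: "norm K \<le> 1" by (rule norm_blinfun_bound) (auto simp: K contr)
  define B where "B = rec_nat 0 (\<lambda>_ X. (1/2) *\<^sub>R (K + (X o\<^sub>L X)))"
  define b :: "nat \<Rightarrow> real" where "b = rec_nat 0 (\<lambda>_ t. (1 + t * t) / 2)"
  have B0: "B 0 = 0" and BS: "\<And>n. B (Suc n) = (1/2) *\<^sub>R (K + (B n o\<^sub>L B n))"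
    by (simp_all add: B_def)
  have b0: "b 0 = 0" and bS: "\<And>n. b (Suc n) = (1 + b n * b n) / 2" by (simp_all add: b_def)
  have b01: "0 \<le> b n \<and> b n \<le> 1" for n
    by (induction n) (auto simp: b0 bS mult_le_one)
  have nB: "norm (B n) \<le> b n" for n
  proof (induction n)
    case (Suc n)
    have "norm (K + (B n o\<^sub>L B n)) \<le> norm K + norm (B n) * norm (B n)"
      by (meson add_left_mono norm_blinfun_compose norm_triangle_le order_refl order_trans)
    also have "\<dots> \<le> 1 + b n * b n" using nK Suc b01 by (intro add_mono mult_mono) auto
    finally show ?case by (simp add: BS bS)
  qed (simp add: B0 b0)
  \<comment> \<open>The scalar iteration t to (1 + t^2)/2 majorises the operator iteration. X^2 -
    Y^2 = X(X - Y) + (X - Y)Y holds without commutativity, and its norm estimate matches the scalar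
    increment.\<close>
  have step: "norm (B (Suc n) - B n) \<le> b (Suc n) - b n" for n
  proof (induction n)
    case 0
    show ?case using nB[of "Suc 0"] by (simp add: B0 b0)
  next
    case (Suc n)
    let ?D = "B (Suc n) - B n"
    have "B (Suc (Suc n)) - B (Suc n)
        = (1/2) *\<^sub>R (K + (B (Suc n) o\<^sub>L B (Suc n))) - (1/2) *\<^sub>R (K + (B n o\<^sub>L B n))"
      by (rule arg_cong2[of _ _ _ _ minus]; rule BS)
    also have "\<dots> = (1/2) *\<^sub>R ((B (Suc n) o\<^sub>L ?D) + (?D o\<^sub>L B n))"
      by (rule blinfun_eqI) (simp add: blinfun.bilinear_simps algebra_simps)
    also have "norm \<dots> \<le> (norm (B (Suc n)) * norm ?D + norm ?D * norm (B n)) / 2"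
      using norm_blinfun_compose[of "B (Suc n)" ?D] norm_blinfun_compose[of ?D "B n"]
        norm_triangle_ineq[of "B (Suc n) o\<^sub>L ?D" "?D o\<^sub>L B n"] by simp
    also have "\<dots> \<le> (b (Suc n) * (b (Suc n) - b n) + (b (Suc n) - b n) * b n) / 2"
    proof -
      have "0 \<le> b (Suc n)" "0 \<le> b (Suc n) - b n"
        using b01[of "Suc n"] order_trans[OF norm_ge_zero Suc] by simp_all
      then show ?thesis
        using nB[of n] nB[of "Suc n"] Suc by (intro divide_right_mono add_mono mult_mono) simp_all
    qed
    also have "\<dots> = (1 + b (Suc n) * b (Suc n)) / 2 - (1 + b n * b n) / 2"
      by (simp add: field_simps)
    also have "\<dots> = b (Suc (Suc n)) - b (Suc n)"
      by (rule arg_cong2[of _ _ _ _ minus]; rule bS[symmetric])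
    finally show ?case .
  qed
  have "b n \<le> b (Suc n)" for n
    using step[of n] norm_ge_zero[of "B (Suc n) - B n"] by linarith
  then have mono: "incseq b" by (rule incseq_SucI)
  have tele: "norm (B (n + k) - B n) \<le> b (n + k) - b n" for n k
  proof (induction k)
    case (Suc k)
    have "B (n + Suc k) - B n = (B (Suc (n + k)) - B (n + k)) + (B (n + k) - B n)" by simp
    also have "norm \<dots> \<le> (b (Suc (n + k)) - b (n + k)) + (b (n + k) - b n)"
      using step Suc by (intro norm_triangle_mono)
    finally show ?case by simp
  qed simp
  \<comment> \<open>The iteration need not contract by a factor below 1, so convergence of
    \<open>B\<close> is taken from that of the bounded increasing sequence \<open>b\<close>.\<close>
  have "Cauchy b"
    using incseq_convergent[OF mono, of 1] b01 LIMSEQ_imp_Cauchy by blast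
  have "Cauchy B"
  proof (rule metric_CauchyI)
    fix e :: real assume "0 < e"
    then obtain N where N: "\<And>m n. m \<ge> N \<Longrightarrow> n \<ge> N \<Longrightarrow> dist (b m) (b n) < e"
      using \<open>Cauchy b\<close> by (meson metric_CauchyD)
    have *: "dist (B m) (B n) < e" if "N \<le> n" "n \<le> m" for m n
      using tele[of n "m - n"] N[of m n] that by (simp add: dist_norm)
    show "\<exists>M. \<forall>m\<ge>M. \<forall>n\<ge>M. dist (B m) (B n) < e"
      using * dist_commute linear by metis
  qed
  then obtain L where L: "B \<longlonglongrightarrow> L" using Cauchy_convergent convergent_def by blast
  have Lx: "(\<lambda>n. B n x) \<longlonglongrightarrow> L x" for x
    using L by (intro tendsto_intros)
  have "(\<lambda>n. B (Suc n)) \<longlonglongrightarrow> (1/2) *\<^sub>R (K + (L o\<^sub>L L))"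
    unfolding BS
    by (intro tendsto_intros L bounded_bilinear.tendsto[OF bounded_bilinear_blinfun_compose])
  then have fixp: "L = (1/2) *\<^sub>R (K + (L o\<^sub>L L))"
    using LIMSEQ_Suc[OF L] LIMSEQ_unique by blast
  have symB: "inner (B n x) y = inner x (B n y)" for n x y
    by (induction n arbitrary: x y)
      (simp_all add: B0 BS K blinfun.bilinear_simps inner_add_left inner_add_right
        symmetric_opD(2)[OF C])
  have symL: "inner (L x) y = inner x (L y)" for x y
  proof (rule LIMSEQ_unique)
    show "(\<lambda>n. inner (B n x) y) \<longlonglongrightarrow> inner (L x) y" by (intro tendsto_intros Lx)
    show "(\<lambda>n. inner (B n x) y) \<longlonglongrightarrow> inner x (L y)" unfolding symB by (intro tendsto_intros Lx)
  qed
  have "norm (B n) \<le> 1" for n using nB[of n] b01[of n] by linarith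
  then have "norm L \<le> 1"
    using LIMSEQ_le_const2[OF tendsto_norm[OF L], of 1] by blast
  then have nL: "norm (L x) \<le> norm x" for x
    using norm_blinfun[of L x] mult_right_mono[of "norm L" 1 "norm x"] by simp
  show thesis
  proof (rule that[of "blinfun_apply L"])
    show "symmetric_op L" by (intro symmetric_opI symL blinfun.bounded_linear_right)
    show "norm (L x) \<le> norm x" for x by (rule nL)
    show "2 *\<^sub>R L x = C x + L (L x)" for x
    proof -
      have "L x = blinfun_apply ((1/2) *\<^sub>R (K + (L o\<^sub>L L))) x"
        using fixp by (rule arg_cong[where f = "\<lambda>M. blinfun_apply M x"])
      also have "\<dots> = (1/2) *\<^sub>R (C x + L (L x))" by (simp add: blinfun.bilinear_simps K)
      finally have "2 *\<^sub>R L x = 2 *\<^sub>R (1/2) *\<^sub>R (C x + L (L x))" by (rule arg_cong)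
      then show ?thesis by simp
    qed
  next
    show "\<forall>D. bounded_linear D \<longrightarrow> (\<forall>x. D (C x) = C (D x)) \<longrightarrow> (\<forall>x. D (L x) = L (D x))"
    proof (intro allI impI)
      fix D x assume D: "bounded_linear D" and DC: "\<forall>x. D (C x) = C (D x)"
      note lin = linear_simps_op[OF D]
      have DB: "D (B n x) = B n (D x)" for n x
        by (induction n arbitrary: x) (simp_all add: B0 BS K blinfun.bilinear_simps lin DC)
      show "D (L x) = L (D x)"
      proof (rule LIMSEQ_unique)
        show "(\<lambda>n. D (B n x)) \<longlonglongrightarrow> D (L x)" by (rule bounded_linear.tendsto[OF D Lx])
        show "(\<lambda>n. D (B n x)) \<longlonglongrightarrow> L (D x)" unfolding DB by (rule Lx)
      qed
    qed
  qed
qed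

text \<open>For \<open>k\<close> bounding the norm of \<open>A\<close>, C = 1 - A/k lies between 0
  and 1 and is a contraction. The fixed point \<open>L\<close> gives (1 - L)^2 = A/k. The
  commutation clause later yields uniqueness and complex linearity of the root.\<close>

lemma nonneg_sqrt_exists:
  fixes A :: "'a::{real_inner,banach} \<Rightarrow> 'a"
  assumes A: "nonneg_op A"
  obtains B where "nonneg_op B" "\<And>x. B (B x) = A x"
    "\<forall>D. bounded_linear D \<longrightarrow> (\<forall>x. D (A x) = A (D x)) \<longrightarrow> (\<forall>x. D (B x) = B (D x))"
proof -
  have symA: "symmetric_op A" and blA: "bounded_linear A"
    using A by (auto intro: nonneg_opD symmetric_opD)
  obtain k where k: "0 < k" "\<And>x. norm (A x) \<le> norm x * k"
    using bounded_linear.pos_bounded[OF blA] by blast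
  define C where "C = (\<lambda>x. x - (1 / k) *\<^sub>R A x)"
  have Cle: "inner (C x) x \<le> inner x x" for x
    using nonneg_opD(2)[OF A, of x] k(1) by (simp add: C_def inner_diff_left)
  have "inner (A x) x \<le> k * inner x x" for x
  proof -
    have "inner (A x) x \<le> norm (A x) * norm x" by (rule norm_cauchy_schwarz)
    also have "\<dots> \<le> (norm x * k) * norm x" by (intro mult_right_mono k) auto
    finally show ?thesis by (simp add: power2_norm_eq_inner[symmetric] power2_eq_square mult_ac)
  qed
  then have Cpos: "0 \<le> inner (C x) x" for x
    using k(1) by (simp add: C_def inner_diff_left field_simps)
  have "symmetric_op (\<lambda>x::'a. x)" by (intro symmetric_opI bounded_linear_ident refl)
  then have symC: "symmetric_op C"
    unfolding C_def by (intro symmetric_op_diff symmetric_op_scaleR symA)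
  then have nC: "norm (C x) \<le> norm x" for x
    by (intro norm_le_of_le_identity nonneg_opI Cpos Cle)
  obtain L where L: "symmetric_op L" "\<And>x. norm (L x) \<le> norm x"
    "\<And>x. 2 *\<^sub>R L x = C x + L (L x)"
    and LD: "\<forall>D. bounded_linear D \<longrightarrow> (\<forall>x. D (C x) = C (D x)) \<longrightarrow> (\<forall>x. D (L x) = L (D x))"
    using quadratic_fixed_point_exists[OF symC nC] by blast
  note linL = linear_simps_op[OF symmetric_opD(1)[OF L(1)]]
  define B where "B = (\<lambda>x. sqrt k *\<^sub>R (x - L x))"
  have "nonneg_op (\<lambda>x. x - L x)"
  proof (rule nonneg_opI)
    show "symmetric_op (\<lambda>x. x - L x)"
      using \<open>symmetric_op (\<lambda>x. x)\<close> L(1) by (rule symmetric_op_diff)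
    fix x
    have "inner (L x) x \<le> norm (L x) * norm x" by (rule norm_cauchy_schwarz)
    also have "\<dots> \<le> norm x * norm x" by (intro mult_right_mono L) auto
    finally show "0 \<le> inner (x - L x) x"
      by (simp add: inner_diff_left power2_norm_eq_inner[symmetric] power2_eq_square)
  qed
  then have "nonneg_op B" unfolding B_def using k(1) by (intro nonneg_op_scaleR) auto
  moreover have "B (B x) = A x" for x
  proof -
    have "B (B x) = k *\<^sub>R (x - 2 *\<^sub>R L x + L (L x))"
      using k(1) by (simp add: B_def linL algebra_simps scaleR_2)
    also have "\<dots> = k *\<^sub>R (x - C x)" by (simp add: L(3))
    finally show ?thesis using k(1) by (simp add: C_def)
  qed
  moreover have "D (B x) = B (D x)"
    if D: "bounded_linear D" and DA: "\<And>x. D (A x) = A (D x)" for D x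
  proof -
    note lin = linear_simps_op[OF D]
    have "\<forall>x. D (C x) = C (D x)" by (simp add: C_def lin DA)
    then have "D (L x) = L (D x)" using LD D by blast
    then show ?thesis by (simp add: B_def lin)
  qed
  ultimately show thesis using that by blast
qed

lemma nonneg_op_eq_0:
  fixes A :: "'a::{real_inner,banach} \<Rightarrow> 'a"
  assumes A: "nonneg_op A" and 0: "inner (A x) x = 0"
  shows "A x = 0"
proof -
  obtain B where B: "nonneg_op B" "\<And>x. B (B x) = A x"
    by (rule nonneg_sqrt_exists[OF A]) (rule that)
  have "inner (B x) (B x) = 0"
    using 0 symmetric_opD(2)[OF nonneg_opD(1)[OF B(1)], of "B x" x] by (simp add: B(2))
  then have "B x = 0" by simp
  then show ?thesis
    using B(2)[of x] linear_simps_op(4)[OF symmetric_opD(1)[OF nonneg_opD(1)[OF B(1)]]] by simp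
qed

text \<open>For commuting roots, (B + D)(B - D) = 0, so with y = B x - D x both forms vanish at y,
  hence B y = D y = 0 and y = 0. In general \<open>B\<close> and \<open>D\<close> are not known to
  commute, but the constructed root \<open>R\<close> commutes with each and is compared with
  both.\<close>

lemma nonneg_sqrt_unique:
  fixes B D :: "'a::{real_inner,banach} \<Rightarrow> 'a"
  assumes B: "nonneg_op B" and D: "nonneg_op D" and eq: "\<And>x. B (B x) = D (D x)"
  shows "B = D"
proof -
  have main: "B' = D'" if B': "nonneg_op B'" and D': "nonneg_op D'"
    and eq': "\<And>x. B' (B' x) = D' (D' x)" and comm: "\<And>x. D' (B' x) = B' (D' x)"
    for B' D' :: "'a \<Rightarrow> 'a"
  proof
    fix x
    note lin = linear_simps_op[OF symmetric_opD(1)[OF nonneg_opD(1)[OF B']]]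
      linear_simps_op[OF symmetric_opD(1)[OF nonneg_opD(1)[OF D']]]
    define y where "y = B' x - D' x"
    have "B' y + D' y = 0" by (simp add: y_def lin eq' comm)
    then have "inner (B' y) y + inner (D' y) y = 0" by (metis inner_add_left inner_zero_left)
    then have "inner (B' y) y = 0" "inner (D' y) y = 0"
      using nonneg_opD(2)[OF B', of y] nonneg_opD(2)[OF D', of y] by linarith+
    then have "B' y = 0" "D' y = 0" using nonneg_op_eq_0 B' D' by blast+
    then have "inner (B' x) y = 0" "inner (D' x) y = 0"
      using symmetric_opD(2)[OF nonneg_opD(1)[OF B'], of x y]
        symmetric_opD(2)[OF nonneg_opD(1)[OF D'], of x y]
      by simp_all
    moreover have "inner y y = inner (B' x) y - inner (D' x) y"
      unfolding y_def by (rule inner_diff_left)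
    ultimately have "inner y y = 0" by simp
    then show "B' x = D' x" by (simp add: y_def)
  qed
  have D2: "nonneg_op (\<lambda>x. D (D x))"
  proof (intro nonneg_opI symmetric_opI)
    note sym = symmetric_opD(2)[OF nonneg_opD(1)[OF D]]
    show "inner (D (D x)) y = inner x (D (D y))" for x y
      using sym[of "D x" y] sym[of x "D y"] by simp
    show "0 \<le> inner (D (D x)) x" for x using sym[of "D x" x] by simp
    have "bounded_linear D" using D by (auto intro: nonneg_opD symmetric_opD)
    then show "bounded_linear (\<lambda>x. D (D x))" by (rule bounded_linear_compose) fact
  qed
  obtain R where R: "nonneg_op R" "\<And>x. R (R x) = D (D x)"
    and comm: "\<forall>E. bounded_linear E \<longrightarrow> (\<forall>x. E (D (D x)) = D (D (E x))) \<longrightarrow> (\<forall>x. E (R x) = R (E x))"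
    using nonneg_sqrt_exists[OF D2] by blast
  have RD: "\<And>E x. bounded_linear E \<Longrightarrow> (\<forall>x. E (D (D x)) = D (D (E x))) \<Longrightarrow> E (R x) = R (E x)"
    using comm by blast
  have "R = B"
  proof (rule main[OF R(1) B])
    show "B (R x) = R (B x)" for x
      using B by (intro RD) (auto intro: nonneg_opD symmetric_opD simp: eq[symmetric])
  qed (simp add: R(2) eq)
  moreover have "R = D"
  proof (rule main[OF R(1) D])
    show "D (R x) = R (D x)" for x
      using D by (intro RD) (auto intro: nonneg_opD symmetric_opD)
  qed (simp add: R(2))
  ultimately show ?thesis by simp
qed

section \<open>Form ranges\<close>

definition form_range :: "('a::real_inner \<Rightarrow> 'a) \<Rightarrow> 'a set" where
  "form_range A = {z. \<exists>k. \<forall>x. (inner z x)\<^sup>2 \<le> k * inner (A x) x}"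

text \<open>Squaring the bound turns the criterion into one on the quadratic form of the composition
  of \<open>M\<close> with \<open>L\<close>, which can be added and compared.\<close>

lemma range_adjoint_eq:
  fixes L :: "'a::{real_inner,banach} \<Rightarrow> 'b::{real_inner,banach}"
  assumes "bounded_linear L" "linear M" "\<And>x y. inner (L x) y = inner x (M y)"
  shows "range M = {z. \<exists>k. \<forall>x. (inner z x)\<^sup>2 \<le> k * inner (L x) (L x)}"
proof -
  have equiv: "(\<exists>c. \<forall>x. \<bar>inner z x\<bar> \<le> c * norm (L x))
      \<longleftrightarrow> (\<exists>k. \<forall>x. (inner z x)\<^sup>2 \<le> k * inner (L x) (L x))" for z
  proof safe
    fix c assume c: "\<forall>x. \<bar>inner z x\<bar> \<le> c * norm (L x)"
    have "(inner z x)\<^sup>2 \<le> c\<^sup>2 * inner (L x) (L x)" for x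
      using power_mono[OF c[rule_format, of x] abs_ge_zero, of 2]
      by (simp add: power_mult_distrib power2_norm_eq_inner)
    then show "\<exists>k. \<forall>x. (inner z x)\<^sup>2 \<le> k * inner (L x) (L x)" by blast
  next
    fix k assume k: "\<forall>x. (inner z x)\<^sup>2 \<le> k * inner (L x) (L x)"
    \<comment> \<open>Nothing fixes the sign of \<open>k\<close>, hence the absolute value under the
      root.\<close>
    have "\<bar>inner z x\<bar> \<le> sqrt \<bar>k\<bar> * norm (L x)" for x
    proof (rule power2_le_imp_le)
      have "k * inner (L x) (L x) \<le> \<bar>k\<bar> * inner (L x) (L x)" by (intro mult_right_mono) auto
      with k[rule_format, of x] have "(inner z x)\<^sup>2 \<le> \<bar>k\<bar> * inner (L x) (L x)" by linarith
      then show "\<bar>inner z x\<bar>\<^sup>2 \<le> (sqrt \<bar>k\<bar> * norm (L x))\<^sup>2"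
        by (simp add: power_mult_distrib power2_norm_eq_inner)
    qed simp
    then show "\<exists>c. \<forall>x. \<bar>inner z x\<bar> \<le> c * norm (L x)" by blast
  qed
  show ?thesis
    by (intro set_eqI) (simp only: range_adjoint_iff[OF assms] equiv mem_Collect_eq)
qed

lemma range_sqrt_eq_form_range:
  fixes B :: "'a::{real_inner,banach} \<Rightarrow> 'a"
  assumes B: "nonneg_op B" and eq: "\<And>x. B (B x) = A x"
  shows "range B = form_range A"
proof -
  note sym = symmetric_opD[OF nonneg_opD(1)[OF B]]
  have "range B = {z. \<exists>k. \<forall>x. (inner z x)\<^sup>2 \<le> k * inner (B x) (B x)}"
    by (intro range_adjoint_eq sym bounded_linear.linear)
  also have "\<dots> = form_range A" unfolding form_range_def
    by (simp add: eq[symmetric] sym(2)[of "B x" for x])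
  finally show ?thesis .
qed

lemma form_range_mono:
  assumes A: "nonneg_op A" and le: "\<And>x. inner (A x) x \<le> inner (B x) x"
  shows "form_range A \<subseteq> form_range B"
proof
  fix z assume "z \<in> form_range A"
  then obtain k where k: "\<And>x. (inner z x)\<^sup>2 \<le> k * inner (A x) x" by (auto simp: form_range_def)
  have "(inner z x)\<^sup>2 \<le> \<bar>k\<bar> * inner (B x) x" for x
  proof -
    have "k * inner (A x) x \<le> \<bar>k\<bar> * inner (A x) x"
      using nonneg_opD(2)[OF A] by (intro mult_right_mono) auto
    moreover have "\<bar>k\<bar> * inner (A x) x \<le> \<bar>k\<bar> * inner (B x) x" by (intro mult_left_mono le) auto
    ultimately show ?thesis using k[of x] by linarith
  qed
  then show "z \<in> form_range B" by (auto simp: form_range_def)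
qed

text \<open>With roots \<open>P\<close> and \<open>Q\<close>, the map x to (P x, Q x) has squared
  norm equal to the form of A + B, and its adjoint (u, v) to P u + Q v has range exactly
  \<open>range P + range Q\<close>. No closure enters.\<close>

lemma form_range_add:
  fixes A B :: "'a::{real_inner,banach} \<Rightarrow> 'a"
  assumes A: "nonneg_op A" and B: "nonneg_op B"
  shows "form_range (\<lambda>x. A x + B x) = form_range A + form_range B"
proof -
  obtain P where P: "nonneg_op P" "\<And>x. P (P x) = A x"
    by (rule nonneg_sqrt_exists[OF A]) (rule that)
  obtain Q where Q: "nonneg_op Q" "\<And>x. Q (Q x) = B x"
    by (rule nonneg_sqrt_exists[OF B]) (rule that)
  note symP = symmetric_opD[OF nonneg_opD(1)[OF P(1)]]
  note symQ = symmetric_opD[OF nonneg_opD(1)[OF Q(1)]]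
  define L where "L = (\<lambda>x. (P x, Q x))"
  define M where "M = (\<lambda>w. P (fst w) + Q (snd w))"
  have "range M = {z. \<exists>k. \<forall>x. (inner z x)\<^sup>2 \<le> k * inner (L x) (L x)}"
  proof (rule range_adjoint_eq)
    show "bounded_linear L" unfolding L_def by (intro bounded_linear_Pair symP symQ)
    show "linear M" unfolding M_def
      by (rule linearI) (simp_all add: linear_simps_op[OF symP(1)] linear_simps_op[OF symQ(1)]
          scaleR_add_right)
    show "inner (L x) y = inner x (M y)" for x y
      by (simp add: L_def M_def inner_prod_def symP(2) symQ(2) inner_add_right)
  qed
  also have "\<dots> = form_range (\<lambda>x. A x + B x)"
    unfolding form_range_def L_def
    by (simp add: inner_prod_def inner_add_left P(2)[symmetric] Q(2)[symmetric]
        symP(2)[of "P x" for x] symQ(2)[of "Q x" for x])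
  finally have "form_range (\<lambda>x. A x + B x) = range M" ..
  also have "\<dots> = range P + range Q"
    by (force simp: M_def set_plus_def image_iff)
  finally show ?thesis using range_sqrt_eq_form_range P Q by metis
qed

section \<open>Symmetric operators with closed range and their inverses\<close>

text \<open>The whole space is the sum of range and kernel.\<close>

definition splits :: "('a::real_inner \<Rightarrow> 'a) \<Rightarrow> bool" where
  "splits A \<longleftrightarrow> (\<forall>x. \<exists>y. A (x - A y) = 0)"

text \<open>The residual of the projection onto the range is orthogonal to the range, hence in the
  kernel by symmetry. From here on \<open>splits\<close> replaces closedness, because it passes to
  positive parts by algebra alone.\<close>

lemma closed_range_splits:
  fixes A :: "'a::{real_inner,banach} \<Rightarrow> 'a"
  assumes A: "symmetric_op A" and "closed (range A)"
  shows "splits A"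
  unfolding splits_def
proof
  fix x
  have "subspace (range A)"
    using bounded_linear.linear[OF symmetric_opD(1)[OF A]] by (intro linear_subspace_image) auto
  then obtain p where p: "p \<in> range A" "\<And>v. v \<in> range A \<Longrightarrow> inner (x - p) v = 0"
    using orthogonal_projection_exists assms(2) by blast
  then obtain y where y: "p = A y" by blast
  have "inner (A (x - A y)) (A (x - A y)) = 0"
    using p(2)[of "A (A (x - A y))"] y by (simp add: symmetric_opD(2)[OF A])
  then show "\<exists>y. A (x - A y) = 0" by auto
qed

text \<open>The kernel component \<open>z - A y\<close> is orthogonal to \<open>A y\<close> by
  symmetry and to \<open>z\<close> by assumption, so it vanishes.\<close>

lemma symmetric_range_memI:
  assumes A: "symmetric_op A" and "splits A" and z: "\<And>x. A x = 0 \<Longrightarrow> inner z x = 0"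
  shows "z \<in> range A"
proof -
  obtain y where y: "A (z - A y) = 0" using \<open>splits A\<close> by (auto simp: splits_def)
  have "inner (A y) (z - A y) = 0" using y by (simp add: symmetric_opD(2)[OF A])
  then have "inner (z - A y) (z - A y) = 0"
    using z[OF y] by (simp add: inner_diff_left[of z "A y" "z - A y"])
  then show ?thesis by auto
qed

text \<open>A vector of \<open>form_range B\<close> annihilates the kernel of \<open>B\<close>,
  hence that of \<open>A\<close>, and so lies in \<open>range A\<close>. Only the inclusion
  \<open>sub\<close> has to be supplied.\<close>

lemma form_range_eq_range:
  assumes A: "symmetric_op A" "splits A" and ker: "\<And>x. A x = 0 \<Longrightarrow> B x = 0"
    and sub: "range A \<subseteq> form_range B"
  shows "form_range B = range A"
proof
  show "form_range B \<subseteq> range A"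
  proof
    fix z assume "z \<in> form_range B"
    then obtain k where k: "\<And>x. (inner z x)\<^sup>2 \<le> k * inner (B x) x" by (auto simp: form_range_def)
    show "z \<in> range A"
      using k ker by (intro symmetric_range_memI[OF A]) (metis inner_zero_left mult_zero_right
          power2_less_eq_zero_iff)
  qed
qed (rule sub)

lemma form_range_nonneg_eq_range:
  fixes A :: "'a::{real_inner,banach} \<Rightarrow> 'a"
  assumes A: "nonneg_op A" "splits A"
  shows "form_range A = range A"
proof (rule form_range_eq_range[OF nonneg_opD(1)[OF A(1)] A(2)])
  obtain P where P: "nonneg_op P" "\<And>x. P (P x) = A x"
    by (rule nonneg_sqrt_exists[OF A(1)]) (rule that)
  then show "range A \<subseteq> form_range A"
    using range_sqrt_eq_form_range[OF P] by (metis image_subsetI rangeI)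
qed

text \<open>
  Baire's theorem applied to the sets of all \<open>z\<close> with \<open>\<bar>\<langle>z, A x\<rangle>\<bar> \<le> n \<parallel>A\<^sup>2 x\<parallel>\<close> for all \<open>x\<close>; these
  exhaust the space because \<open>\<langle>A y + q, A x\<rangle> = \<langle>y, A\<^sup>2 x\<rangle>\<close> for \<open>q\<close> in the kernel.
\<close>

lemma bounded_below_on_range:
  fixes A :: "'a::{real_inner,banach} \<Rightarrow> 'a"
  assumes A: "symmetric_op A" "splits A"
  obtains c where "0 \<le> c" "\<And>x. norm (A x) \<le> c * norm (A (A x))"
proof -
  note sym = symmetric_opD(2)[OF A(1)]
  define F where "F = (\<lambda>n::nat. {z. \<forall>x. \<bar>inner z (A x)\<bar> \<le> real n * norm (A (A x))})"
  have clF: "closed (F n)" for n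
    unfolding F_def by (intro closed_Collect_all closed_Collect_le continuous_intros)
  have "\<exists>n. z \<in> F n" for z
  proof -
    obtain y where y: "A (z - A y) = 0" using A(2) by (auto simp: splits_def)
    obtain n where n: "norm y \<le> real n" using real_arch_simple by blast
    have "\<bar>inner z (A x)\<bar> \<le> real n * norm (A (A x))" for x
    proof -
      have "inner (z - A y) (A x) = 0" using y sym[of "z - A y" x] by simp
      then have "inner z (A x) = inner y (A (A x))" by (simp add: inner_diff_left sym)
      also have "\<bar>\<dots>\<bar> \<le> norm y * norm (A (A x))" by (rule Cauchy_Schwarz_ineq2)
      also have "\<dots> \<le> real n * norm (A (A x))" using n by (intro mult_right_mono) auto
      finally show ?thesis .
    qed
    then show ?thesis by (auto simp: F_def)
  qed
  then have UN: "\<Union>(range F) = UNIV" by blast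
  have "\<exists>n. interior (F n) \<noteq> {}"
  proof (rule ccontr)
    assume "\<nexists>n. interior (F n) \<noteq> {}"
    moreover have "completely_metrizable_space (euclidean :: 'a topology)"
      using Met_TC.completely_metrizable_space_mtopology complete_UNIV by auto
    ultimately have "euclidean interior_of \<Union>(range F) = {}"
      using clF by (intro Baire_category_alt) auto
    then show False using UN by simp
  qed
  then obtain n z where "z \<in> interior (F n)" by blast
  then obtain r where r: "0 < r" "ball z r \<subseteq> F n" by (meson mem_interior)
  have zF: "z \<in> F n" using r by auto
  have "norm (A x) \<le> (4 * real n / r) * norm (A (A x))" for x
  proof (cases "A x = 0")
    case False
    \<comment> \<open>\<open>w\<close> points along \<open>A x\<close> with length
      \<open>r / 2\<close>, so \<open>z + w\<close> stays in the ball. The bounds at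
      \<open>z + w\<close> and at \<open>z\<close> together bound
      \<open>inner w (A x)\<close>.\<close>
    define w where "w = (r / (2 * norm (A x))) *\<^sub>R A x"
    have "norm w = r / 2" using False r(1) by (simp add: w_def)
    then have "z + w \<in> F n" using r by (intro subsetD[OF r(2)]) (simp add: dist_norm)
    then have "\<bar>inner (z + w) (A x)\<bar> \<le> real n * norm (A (A x))" by (simp add: F_def)
    moreover have "\<bar>inner z (A x)\<bar> \<le> real n * norm (A (A x))" using zF by (simp add: F_def)
    ultimately have "inner w (A x) \<le> 2 * real n * norm (A (A x))"
      by (simp add: inner_add_left)
    moreover have "inner w (A x) = r / 2 * norm (A x)"
      using False by (simp add: w_def power2_norm_eq_inner[symmetric] power2_eq_square)
    ultimately show ?thesis using r(1) by (simp add: field_simps)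
  qed (use r(1) in simp)
  then show thesis using r(1) by (intro that[of "4 * real n / r"]) auto
qed

text \<open>Splitting twice gives \<open>w\<close> with x - A^2 w in the kernel, and X x = A w
  inverts \<open>A\<close> on its range and kills the kernel. For symmetric \<open>A\<close> this
  will be the Moore-Penrose inverse, characterised here purely algebraically.\<close>

lemma symmetric_group_inverse_exists:
  fixes A :: "'a::{real_inner,banach} \<Rightarrow> 'a"
  assumes A: "symmetric_op A" "splits A"
  obtains X where "symmetric_op X" "\<And>x. A (X (A x)) = A x" "\<And>x. X (A (X x)) = X x"
    "\<forall>D. linear D \<longrightarrow> (\<forall>x. D (A x) = A (D x)) \<longrightarrow> (\<forall>x. D (X x) = X (D x))"
proof -
  note sym = symmetric_opD(2)[OF A(1)] and lin = linear_simps_op[OF symmetric_opD(1)[OF A(1)]]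
  have "\<exists>w. A (x - A (A w)) = 0" for x
  proof -
    obtain y where y: "A (x - A y) = 0" using A(2) by (auto simp: splits_def)
    obtain w where w: "A (y - A w) = 0" using A(2) by (auto simp: splits_def)
    have "A y = A (A w)" using w by (simp add: lin)
    with y show ?thesis by auto
  qed
  then obtain W where W: "\<And>x. A (x - A (A (W x))) = 0" by metis
  define X where "X = (\<lambda>x. A (W x))"
  have AX: "A (A (X x)) = A x" for x using W[of x] by (simp add: X_def lin)
  \<comment> \<open>\<open>X x\<close> does not depend on the chosen solution, because A^3 d = 0
    forces A d = 0 for symmetric \<open>A\<close>. Linearity and commutation are
    consequences.\<close>
  have unique: "X x = A w" if "A (A (A w)) = A x" for x w
  proof -
    define d where "d = W x - w"
    have "A (A (A d)) = 0" using that AX[of x] by (simp add: d_def lin X_def)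
    then have "inner (A (A d)) (A (A d)) = 0" using sym[of "A (A d)" "A d"] by simp
    then have "A (A d) = 0" by simp
    then have "inner (A d) (A d) = 0" using sym[of "A d" d] by simp
    then show ?thesis by (simp add: d_def lin X_def)
  qed
  \<comment> \<open>If \<open>D\<close> commutes with \<open>A\<close>, then \<open>D (W x)\<close>
    solves the defining equation for \<open>D x\<close>.\<close>
  have comm: "D (X x) = X (D x)" if D: "linear D" and DA: "\<forall>x. D (A x) = A (D x)" for D x
  proof -
    have "A (A (A (D (W x)))) = D (A (A (X x)))" by (simp add: X_def DA)
    also have "\<dots> = A (D x)" by (simp add: AX DA)
    finally have "X (D x) = A (D (W x))" by (rule unique)
    then show ?thesis by (simp add: X_def DA)
  qed
  obtain c where c: "0 \<le> c" "\<And>x. norm (A x) \<le> c * norm (A (A x))"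
    using bounded_below_on_range[OF A] by blast
  have "bounded_linear X"
  proof (rule bounded_linear_intro)
    show "X (x + y) = X x + X y" for x y
      using AX[of x] AX[of y] unique[of "W x + W y" "x + y"] by (simp add: X_def lin)
    show "X (a *\<^sub>R x) = a *\<^sub>R X x" for a x
      using AX[of x] unique[of "a *\<^sub>R W x" "a *\<^sub>R x"] by (simp add: X_def lin)
    fix x
    \<comment> \<open>\<open>A (X x)\<close> is the orthogonal projection of \<open>x\<close>, so
      its norm is at most that of \<open>x\<close>. The lower bound for \<open>A\<close> on its
      range then bounds \<open>X x\<close>.\<close>
    have "inner (A (X x)) (x - A (X x)) = 0"
      using sym[of "X x" "x - A (X x)"] by (simp add: lin AX)
    then have "norm (A (X x)) * norm (A (X x)) = inner (A (X x)) x"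
      by (simp add: inner_diff_right power2_norm_eq_inner[symmetric] power2_eq_square)
    also have "\<dots> \<le> norm (A (X x)) * norm x" by (rule norm_cauchy_schwarz)
    finally have "norm (A (X x)) \<le> norm x"
      by (cases "A (X x) = 0") simp_all
    then have "c * norm (A (X x)) \<le> norm x * c" using c(1) by (simp add: mult.commute[of _ c] mult_left_mono)
    then show "norm (X x) \<le> norm x * c" using c(2)[of "W x"] by (simp add: X_def)
  qed
  moreover have "inner (X x) y = inner x (X y)" for x y
  proof -
    have half: "inner (X u) v = inner (X u) (A (X v))" for u v
    proof -
      have "inner (X u) (v - A (X v)) = 0" using W[of v] by (simp add: X_def sym)
      then show ?thesis by (simp add: inner_diff_right)
    qed
    show ?thesis using half[of x y] half[of y x] sym[of "X x" "X y"]
      by (simp add: inner_commute)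
  qed
  ultimately have symX: "symmetric_op X" by (rule symmetric_opI)
  have "A (X x) = X (A x)" for x
    by (intro comm bounded_linear.linear symmetric_opD(1)[OF A(1)]) simp
  then have AXA: "A (X (A x)) = A x" for x using AX[of x] by simp
  have XAX: "X (A (X x)) = X x" for x
    using unique[of "W x" "A (X x)"] by (simp add: X_def)
  show thesis by (rule that[OF symX AXA XAX]) (use comm in blast)
qed

section \<open>Positive parts and their conjugates\<close>

text \<open>\<open>R\<close> stands for the modulus of \<open>A\<close>. From R^2 = A^2 and
  commutation, A P = P A = R P = P^2, and everything else is derived from these identities without
  spectral theory.\<close>

lemma modulus_positive_part:
  assumes A: "symmetric_op A" "splits A" and R: "nonneg_op R"
    and RR: "\<And>x. R (R x) = A (A x)" and RA: "\<And>x. R (A x) = A (R x)"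
  defines "P \<equiv> \<lambda>x. (R x + A x) /\<^sub>R 2"
  shows "nonneg_op P" "splits P" "range P \<subseteq> range A" "\<And>x. A x = 0 \<Longrightarrow> P x = 0"
    "\<And>x. A (P x) = P (P x)"
proof -
  note symR = nonneg_opD(1)[OF R]
  note lin = linear_simps_op[OF symmetric_opD(1)[OF A(1)]] linear_simps_op[OF symmetric_opD(1)[OF symR]]
  have symP: "symmetric_op P"
    unfolding P_def by (intro symmetric_op_scaleR symmetric_op_add symR A)
  note linP = linear_simps_op[OF symmetric_opD(1)[OF symP]] and sP = symmetric_opD(2)[OF symP]
  show ker: "P x = 0" if "A x = 0" for x
  proof -
    have "inner (R x) (R x) = 0"
      using that symmetric_opD(2)[OF symR, of "R x" x] by (simp add: RR lin)
    then show ?thesis using that by (simp add: P_def)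
  qed
  show AP: "A (P x) = P (P x)" for x
  proof -
    have "P (P x) = (1/4) *\<^sub>R (R (R x + A x) + A (R x + A x))"
      unfolding P_def by (simp only: lin(3) lin(8) scaleR_add_right[symmetric]) simp
    also have "R (R x + A x) + A (R x + A x) = 2 *\<^sub>R A (R x + A x)"
      by (simp add: lin RR RA scaleR_2)
    finally show ?thesis unfolding P_def by (simp add: lin(3))
  qed
  have PA: "P (A x) = P (P x)" for x
    unfolding AP[symmetric] by (simp add: P_def lin RA)
  have RP: "R (P x) = P (P x)" for x
    unfolding AP[symmetric] by (simp add: P_def lin RR RA add.commute)
  \<comment> \<open>\<open>x - A y\<close> is killed by \<open>A\<close>, hence by \<open>P\<close>,
    and P A = P^2. So \<open>P\<close> and its square have the same range.\<close>
  have dec: "\<exists>y. P x = P (P y)" for x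
  proof -
    obtain y where "A (x - A y) = 0" using A(2) by (auto simp: splits_def)
    then have "P (x - A y) = 0" by (rule ker)
    then show ?thesis using PA[of y] by (auto simp: linP)
  qed
  then show "splits P" by (auto simp: splits_def linP)
  \<comment> \<open>Writing P x = P (P y) moves the form of \<open>P\<close> at \<open>x\<close> to
    the form of \<open>R\<close> at \<open>P y\<close>.\<close>
  show "nonneg_op P"
  proof (rule nonneg_opI[OF symP])
    fix x
    obtain y where y: "P x = P (P y)" using dec by blast
    have "inner (P x) x = inner (P y) (P x)" using sP[of "P y" x] y by simp
    also have "\<dots> = inner (R (P y)) (P y)" by (simp add: y RP inner_commute)
    finally show "0 \<le> inner (P x) x" using nonneg_opD(2)[OF R] by simp
  qed
  show "range P \<subseteq> range A"
    using ker by (auto intro!: symmetric_range_memI[OF A] simp: sP)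
qed

lemma symmetric_op_uminus: "symmetric_op A \<Longrightarrow> symmetric_op (\<lambda>x. - A x)"
  by (auto simp: symmetric_op_def bounded_linear_minus)

lemma splits_uminus:
  assumes "symmetric_op A" "splits A"
  shows "splits (\<lambda>x. - A x)"
  unfolding splits_def
proof
  fix x
  obtain y where "A (x - A y) = 0" using assms(2) by (auto simp: splits_def)
  then show "\<exists>y. - A (x - - A y) = 0"
    by (intro exI[of _ "- y"]) (simp add: linear_simps_op[OF symmetric_opD(1)[OF assms(1)]])
qed

lemma conjugate_nonneg_op:
  assumes X: "symmetric_op X" and P: "nonneg_op P"
  shows "nonneg_op (\<lambda>x. X (P (X x)))"
proof (intro nonneg_opI symmetric_opI)
  note sX = symmetric_opD[OF X] and sP = symmetric_opD[OF nonneg_opD(1)[OF P]]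
  show "bounded_linear (\<lambda>x. X (P (X x)))"
    by (intro bounded_linear_compose[OF sX(1)] bounded_linear_compose[OF sP(1)] sX(1))
  show "inner (X (P (X x))) y = inner x (X (P (X y)))" for x y by (simp add: sX(2) sP(2))
  show "0 \<le> inner (X (P (X x))) x" for x
    using nonneg_opD(2)[OF P, of "X x"] by (simp add: sX(2))
qed

text \<open>With a root \<open>B\<close> of \<open>P\<close>, the form of X P X at x is the squared
  norm of B X x, so its form range is the range of the adjoint X B. This contains
  \<open>range P\<close> because X P^2 = X B (B P).\<close>

lemma form_range_conjugate:
  fixes P X :: "'a::{real_inner,banach} \<Rightarrow> 'a"
  assumes X: "symmetric_op X" and P: "nonneg_op P" "splits P"
    and comm: "\<And>x. P (X x) = X (P x)" and inv: "\<And>y. \<exists>w. P y = X (P (P w))"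
  shows "form_range (\<lambda>x. X (P (X x))) = range P"
proof (rule form_range_eq_range[OF nonneg_opD(1)[OF P(1)] P(2)])
  note sX = symmetric_opD[OF X] and sP = symmetric_opD[OF nonneg_opD(1)[OF P(1)]]
  show "X (P (X x)) = 0" if "P x = 0" for x
    using that by (simp add: comm linear_simps_op[OF sX(1)])
  obtain B where B: "nonneg_op B" "\<And>x. B (B x) = P x"
    by (rule nonneg_sqrt_exists[OF P(1)]) (rule that)
  note sB = symmetric_opD[OF nonneg_opD(1)[OF B(1)]]
  have "range (\<lambda>u. X (B u)) = {z. \<exists>k. \<forall>x. (inner z x)\<^sup>2 \<le> k * inner (B (X x)) (B (X x))}"
    using sX sB by (intro range_adjoint_eq bounded_linear.linear)
      (auto intro: bounded_linear_compose)
  also have "\<dots> = form_range (\<lambda>x. X (P (X x)))"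
    unfolding form_range_def by (simp add: B(2)[symmetric] sX(2)[of "B x" for x] sB(2)[of "B x" for x])
  finally show "range P \<subseteq> form_range (\<lambda>x. X (P (X x)))"
    using inv B(2) by (metis image_subsetI rangeI)
qed

section \<open>Adjoints and the passage between real and complex structure\<close>

lemma bounded_linear_adjoint_exists:
  fixes A :: "'a::{real_inner,banach} \<Rightarrow> 'a"
  assumes A: "bounded_linear A"
  obtains B where "bounded_linear B" "\<And>x y. inner (A x) y = inner x (B y)"
proof -
  have "\<exists>z. \<forall>x. inner (A x) y = inner x z" for y
  proof -
    have "bounded_linear (\<lambda>x. inner (A x) y)"
      using bounded_linear_compose[OF bounded_linear_inner_left A] .
    then show ?thesis using riesz_representation by blast
  qed
  then obtain B where B: "\<And>x y. inner (A x) y = inner x (B y)" by metis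
  obtain K where K: "0 \<le> K" "\<And>x. norm (A x) \<le> norm x * K"
    using bounded_linear.nonneg_bounded[OF A] by blast
  have "bounded_linear B"
  proof (rule bounded_linear_intro)
    show "B (y + z) = B y + B z" for y z
      by (rule vector_eq_ldot[THEN iffD1]) (simp add: B[symmetric] inner_add_right)
    show "B (r *\<^sub>R y) = r *\<^sub>R B y" for r y
      by (rule vector_eq_ldot[THEN iffD1]) (simp add: B[symmetric])
    fix y
    have "norm (B y) * norm (B y) = inner (A (B y)) y"
      by (simp add: B power2_norm_eq_inner[symmetric] power2_eq_square)
    also have "\<dots> \<le> norm (A (B y)) * norm y" by (rule norm_cauchy_schwarz)
    also have "\<dots> \<le> norm (B y) * K * norm y" using K by (intro mult_right_mono) auto
    finally have "norm (B y) * norm (B y) \<le> norm (B y) * (norm y * K)" by (simp add: mult_ac)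
    then show "norm (B y) \<le> norm y * K"
      by (cases "B y = 0") (simp_all add: K)
  qed
  with B show thesis by (intro that)
qed

lemma cinner_scaleC_right: "cinner x (c *\<^sub>C y) = cnj c * cinner x y"
  by (metis cinner_commute cinner_scaleC_left complex_cnj_mult)

lemma inner_scaleC_right: "inner x (c *\<^sub>C y) = inner (cnj c *\<^sub>C x) y"
  by (simp add: Re_cinner[symmetric] cinner_scaleC_right cinner_scaleC_left)

lemma Im_cinner: "Im (cinner x y) = inner ((- \<i>) *\<^sub>C x) y"
  by (simp add: Re_cinner[symmetric] cinner_scaleC_left)

lemma norm_scaleC: "norm (c *\<^sub>C x) = cmod c * norm x"
proof -
  have "inner (c *\<^sub>C x) (c *\<^sub>C x) = Re ((c * cnj c) * cinner x x)"
    by (simp only: Re_cinner[symmetric] cinner_scaleC_right cinner_scaleC_left mult_ac)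
  also have "\<dots> = (cmod c)\<^sup>2 * inner x x"
    by (simp only: complex_norm_square[symmetric] Re_cinner[symmetric] Re_complex_of_real
        times_complex.sel Im_complex_of_real)
  finally show ?thesis by (simp add: norm_eq_sqrt_inner real_sqrt_mult)
qed

lemma bounded_linear_scaleC: "bounded_linear (\<lambda>x::'a::complex_hilbert_space. c *\<^sub>C x)"
proof (rule bounded_linear_intro)
  show "c *\<^sub>C r *\<^sub>R x = r *\<^sub>R c *\<^sub>C x" for r and x :: 'a
    by (simp add: scaleC_of_real[symmetric] scaleC_scaleC mult.commute)
  show "norm (c *\<^sub>C x) \<le> norm x * cmod c" for x :: 'a by (simp add: norm_scaleC)
qed (rule scaleC_add_right)

lemma scaleC_minus_right: "c *\<^sub>C (- x) = - (c *\<^sub>C x)"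
  by (rule linear_simps_op(5)[OF bounded_linear_scaleC])

lemma bounded_clinearD:
  assumes "bounded_clinear A"
  shows "bounded_linear A" and "A (c *\<^sub>C x) = c *\<^sub>C A x"
  using assms by (auto simp: bounded_clinear_def)

text \<open>The imaginary part of \<open>cinner\<close> is the real form after multiplying the first
  argument by -i, and \<open>A\<close> commutes with that multiplication.\<close>

lemma cinner_adjoint_iff:
  assumes A: "bounded_clinear A"
  shows "(\<forall>x y. cinner (A x) y = cinner x (B y)) \<longleftrightarrow> (\<forall>x y. inner (A x) y = inner x (B y))"
proof
  assume "\<forall>x y. cinner (A x) y = cinner x (B y)"
  then show "\<forall>x y. inner (A x) y = inner x (B y)" by (simp add: Re_cinner[symmetric])
next
  assume eq: "\<forall>x y. inner (A x) y = inner x (B y)"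
  have "Im (cinner (A x) y) = Im (cinner x (B y))" for x y
    unfolding Im_cinner bounded_clinearD(2)[OF A, symmetric] using eq by blast
  with eq show "\<forall>x y. cinner (A x) y = cinner x (B y)" by (simp add: complex_eq_iff Re_cinner)
qed

text \<open>\<open>cadjoint\<close> is a definite description, so an adjoint must first be shown to
  exist. The real adjoint is complex linear because multiplication by \<open>c\<close> has adjoint
  multiplication by \<open>cnj c\<close>, with which \<open>A\<close> commutes.\<close>

lemma selfadjoint_iff_symmetric:
  assumes A: "bounded_clinear A"
  shows "selfadjoint A \<longleftrightarrow> symmetric_op A"
proof -
  obtain B where B: "bounded_linear B" "\<And>x y. inner (A x) y = inner x (B y)"
    using bounded_linear_adjoint_exists bounded_clinearD(1)[OF A] by blast
  have "B (c *\<^sub>C y) = c *\<^sub>C B y" for c y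
    by (rule vector_eq_ldot[THEN iffD1])
      (simp add: B(2)[symmetric] inner_scaleC_right bounded_clinearD(2)[OF A])
  then have "bounded_clinear B" using B(1) by (simp add: bounded_clinear_def)
  moreover have unique: "B' = B" if "\<forall>x y. inner (A x) y = inner x (B' y)" for B'
  proof
    show "B' y = B y" for y
      by (rule vector_eq_ldot[THEN iffD1]) (use that B(2) in simp)
  qed
  ultimately have "cadjoint A = B"
    unfolding cadjoint_def cinner_adjoint_iff[OF A] by (intro the_equality) (simp_all add: B(2))
  then have "selfadjoint A \<longleftrightarrow> B = A" by (simp add: selfadjoint_def)
  also have "\<dots> \<longleftrightarrow> symmetric_op A"
  proof
    show "symmetric_op A" if "B = A" using B that by (simp add: symmetric_op_def)
    show "B = A" if "symmetric_op A"
      using unique[of A] symmetric_opD(2)[OF that] by simp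
  qed
  finally show ?thesis .
qed

lemma positive_op_iff: "positive_op A \<longleftrightarrow> bounded_clinear A \<and> nonneg_op A"
  by (auto simp: positive_op_def loewner_le_def nonneg_op_def selfadjoint_iff_symmetric Re_cinner)

section \<open>Square root, modulus, parts and Moore-Penrose inverse of complex operators\<close>

lemma sqrt_op_properties:
  assumes A: "bounded_clinear A" "nonneg_op A"
  shows "bounded_clinear (sqrt_op A)" and "nonneg_op (sqrt_op A)"
    and "sqrt_op A (sqrt_op A x) = A x"
    and "bounded_linear D \<Longrightarrow> (\<And>x. D (A x) = A (D x)) \<Longrightarrow> D (sqrt_op A x) = sqrt_op A (D x)"
proof -
  obtain B where B: "nonneg_op B" "\<And>x. B (B x) = A x"
    and comm: "\<forall>D. bounded_linear D \<longrightarrow> (\<forall>x. D (A x) = A (D x)) \<longrightarrow> (\<forall>x. D (B x) = B (D x))"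
    by (rule nonneg_sqrt_exists[OF A(2)]) (rule that)
  have clB: "bounded_clinear B"
    unfolding bounded_clinear_def
  proof (intro conjI allI)
    show "bounded_linear B" using B by (intro symmetric_opD nonneg_opD)
    show "B (c *\<^sub>C x) = c *\<^sub>C B x" for c x
      using comm bounded_linear_scaleC[of c] bounded_clinearD(2)[OF A(1)] by metis
  qed
  have eq: "sqrt_op A = B"
    unfolding sqrt_op_def positive_op_iff
  proof (rule the_equality)
    fix B' assume B': "(bounded_clinear B' \<and> nonneg_op B') \<and> B' \<circ> B' = A"
    then have "B' (B' x) = B (B x)" for x using B(2) by (metis comp_apply)
    with B' B(1) show "B' = B" by (intro nonneg_sqrt_unique) auto
  qed (use B clB in auto)
  show "bounded_clinear (sqrt_op A)" "nonneg_op (sqrt_op A)" "sqrt_op A (sqrt_op A x) = A x"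
    using B clB by (simp_all add: eq)
  show "D (sqrt_op A x) = sqrt_op A (D x)" if "bounded_linear D" "\<And>x. D (A x) = A (D x)"
    using comm that by (simp add: eq)
qed

lemma range_sqrt_op:
  assumes "bounded_clinear A" "nonneg_op A"
  shows "range (sqrt_op A) = form_range A"
  by (rule range_sqrt_eq_form_range[OF sqrt_op_properties(2,3)[OF assms]])

lemma abs_op_properties:
  assumes A: "bounded_clinear A" "symmetric_op A"
  shows "bounded_clinear (abs_op A)" and "nonneg_op (abs_op A)"
    and "abs_op A (abs_op A x) = A (A x)"
    and "bounded_linear D \<Longrightarrow> (\<And>x. D (A x) = A (D x)) \<Longrightarrow> D (abs_op A x) = abs_op A (D x)"
proof -
  have "cadjoint A = A" using A by (simp add: selfadjoint_def[symmetric] selfadjoint_iff_symmetric)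
  then have eq: "abs_op A = sqrt_op (\<lambda>x. A (A x))" by (simp add: abs_op_def comp_def)
  note bl = symmetric_opD(1)[OF A(2)]
  have cl: "bounded_clinear (\<lambda>x. A (A x))"
    using bounded_linear_compose[OF bl bl] bounded_clinearD(2)[OF A(1)]
    by (simp add: bounded_clinear_def)
  have nn: "nonneg_op (\<lambda>x. A (A x))"
  proof (intro nonneg_opI symmetric_opI)
    show "0 \<le> inner (A (A x)) x" for x using symmetric_opD(2)[OF A(2), of "A x" x] by simp
  qed (simp_all add: symmetric_opD(2)[OF A(2)] bounded_linear_compose[OF bl bl])
  show "bounded_clinear (abs_op A)" "nonneg_op (abs_op A)" "abs_op A (abs_op A x) = A (A x)"
    using sqrt_op_properties(1-3)[OF cl nn] by (simp_all add: eq)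
  show "D (abs_op A x) = abs_op A (D x)" if "bounded_linear D" "\<And>x. D (A x) = A (D x)"
    unfolding eq by (rule sqrt_op_properties(4)[OF cl nn]) (simp_all add: that)
qed

lemma pos_part_minus_neg_part: "pos_part A x - neg_part A x = A x"
proof -
  have "(abs_op A x + A x) - (abs_op A x - A x) = 2 *\<^sub>R A x" by (simp add: scaleR_2)
  then show ?thesis unfolding pos_part_def neg_part_def scaleR_diff_right[symmetric] by simp
qed

lemma pos_part_properties:
  assumes A: "bounded_clinear A" "symmetric_op A" "splits A"
  shows "bounded_clinear (pos_part A)" and "nonneg_op (pos_part A)" and "splits (pos_part A)"
    and "range (pos_part A) \<subseteq> range A" and "A x = 0 \<Longrightarrow> pos_part A x = 0"
    and "A (pos_part A x) = pos_part A (pos_part A x)"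
    and "bounded_linear D \<Longrightarrow> (\<And>x. D (A x) = A (D x)) \<Longrightarrow> D (pos_part A x) = pos_part A (D x)"
proof -
  note R = abs_op_properties[OF A(1,2)]
  have RA: "abs_op A (A x) = A (abs_op A x)" for x
    using R(4)[OF bounded_clinearD(1)[OF A(1)], of x] by simp
  note pp = modulus_positive_part[OF A(2,3), where R = "abs_op A", OF R(2) R(3) RA]
  show nn: "nonneg_op (pos_part A)" unfolding pos_part_def by (fact pp)
  show "splits (pos_part A)" "range (pos_part A) \<subseteq> range A"
    "A x = 0 \<Longrightarrow> pos_part A x = 0" "A (pos_part A x) = pos_part A (pos_part A x)"
    unfolding pos_part_def by (fact pp)+
  show comm: "D (pos_part A x) = pos_part A (D x)"
    if D: "bounded_linear D" "\<And>x. D (A x) = A (D x)" for D x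
    using R(4)[OF D] by (simp add: pos_part_def linear_simps_op[OF D(1)] D(2))
  have "c *\<^sub>C pos_part A x = pos_part A (c *\<^sub>C x)" for c x
    by (rule comm[OF bounded_linear_scaleC]) (simp add: bounded_clinearD(2)[OF A(1)])
  then show "bounded_clinear (pos_part A)"
    using nn by (auto simp: bounded_clinear_def nonneg_op_def symmetric_op_def)
qed

text \<open>\<open>A\<close> and its negative have the same square, hence the same modulus by
  uniqueness of roots. All facts on negative parts can thus be read off from positive parts.\<close>

lemma neg_part_eq: "bounded_clinear A \<Longrightarrow> symmetric_op A \<Longrightarrow> neg_part A = pos_part (\<lambda>x. - A x)"
proof -
  assume A: "bounded_clinear A" "symmetric_op A"
  note lin = linear_simps_op[OF bounded_clinearD(1)[OF A(1)]]
  have cl: "bounded_clinear (\<lambda>x. - A x)"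
    using A(1) by (simp add: bounded_clinear_def bounded_linear_minus scaleC_minus_right)
  have "abs_op (\<lambda>x. - A x) = abs_op A"
    using abs_op_properties(2,3)[OF A] abs_op_properties(2,3)[OF cl symmetric_op_uminus[OF A(2)]]
    by (intro nonneg_sqrt_unique) (simp_all add: lin)
  then show ?thesis by (simp add: pos_part_def neg_part_def)
qed

lemma neg_part_properties:
  assumes A: "bounded_clinear A" "symmetric_op A" "splits A"
  shows "bounded_clinear (neg_part A)" and "nonneg_op (neg_part A)" and "splits (neg_part A)"
    and "range (neg_part A) \<subseteq> range A" and "A x = 0 \<Longrightarrow> neg_part A x = 0"
    and "A (neg_part A x) = - neg_part A (neg_part A x)"
    and "bounded_linear D \<Longrightarrow> (\<And>x. D (A x) = A (D x)) \<Longrightarrow> D (neg_part A x) = neg_part A (D x)"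
proof -
  have cl: "bounded_clinear (\<lambda>x. - A x)"
    using A(1) by (simp add: bounded_clinear_def bounded_linear_minus scaleC_minus_right)
  note pp = pos_part_properties[OF cl symmetric_op_uminus[OF A(2)] splits_uminus[OF A(2,3)],
      folded neg_part_eq[OF A(1,2)]]
  have "- A x = A (- x)" for x
    using linear_simps_op(5)[OF bounded_clinearD(1)[OF A(1)]] by simp
  then have "range (\<lambda>x. - A x) \<subseteq> range A" by auto
  with pp(4) show "range (neg_part A) \<subseteq> range A" by (rule order_trans)
  show "bounded_clinear (neg_part A)" "nonneg_op (neg_part A)" "splits (neg_part A)"
    by (fact pp)+
  show "A x = 0 \<Longrightarrow> neg_part A x = 0" by (rule pp(5)) simp
  show "A (neg_part A x) = - neg_part A (neg_part A x)"
    using pp(6)[of x] by (metis minus_minus)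
  show "D (neg_part A x) = neg_part A (D x)"
    if D: "bounded_linear D" "\<And>x. D (A x) = A (D x)"
    by (rule pp(7)[OF D(1)]) (simp add: linear_simps_op[OF D(1)] D(2))
qed

text \<open>The group inverse \<open>X\<close> commutes with \<open>A\<close>, and A X is the
  orthogonal projection onto the range, so \<open>X\<close> meets all defining conditions. Any other
  solution \<open>Y\<close> has the same two projections, whence Y = Y A Y = Y A X = X A X =
  X.\<close>

lemma mp_inverse_properties:
  assumes A: "bounded_clinear A" "symmetric_op A" "splits A"
  shows "symmetric_op (mp_inverse A)"
    and "A (mp_inverse A (A x)) = A x" and "mp_inverse A (A (mp_inverse A x)) = mp_inverse A x"
    and "linear D \<Longrightarrow> (\<And>x. D (A x) = A (D x)) \<Longrightarrow> D (mp_inverse A x) = mp_inverse A (D x)"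
proof -
  obtain X where X: "symmetric_op X" "\<And>x. A (X (A x)) = A x" "\<And>x. X (A (X x)) = X x"
    and comm: "\<forall>D. linear D \<longrightarrow> (\<forall>x. D (A x) = A (D x)) \<longrightarrow> (\<forall>x. D (X x) = X (D x))"
    by (rule symmetric_group_inverse_exists[OF A(2,3)]) (rule that)
  note lin = linear_simps_op[OF symmetric_opD(1)[OF A(2)]] and sA = symmetric_opD(2)[OF A(2)]
  have AX: "A (X x) = X (A x)" for x
    using comm bounded_linear.linear[OF symmetric_opD(1)[OF A(2)]] by blast
  have clX: "bounded_clinear X"
    unfolding bounded_clinear_def
  proof (intro conjI allI)
    show "bounded_linear X" by (rule symmetric_opD[OF X(1)])
    show "X (c *\<^sub>C x) = c *\<^sub>C X x" for c x
      using comm bounded_linear.linear[OF bounded_linear_scaleC[of c]] bounded_clinearD(2)[OF A(1)]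
      by metis
  qed
  have adj: "cadjoint A = A" using A by (simp add: selfadjoint_def[symmetric] selfadjoint_iff_symmetric)
  have proj: "orth_proj (range A) x = A (X x)" for x
    unfolding orth_proj_def
  proof (rule the_equality)
    have orth: "cinner (x - A (X x)) (A v) = 0" for v
    proof -
      have "cinner (A u) y = cinner u (A y)" for u y
        using cinner_adjoint_iff[OF A(1), of A] sA by blast
      moreover have "A (x - A (X x)) = 0" using X(2)[of x] AX by (simp add: lin)
      moreover have "cinner 0 v = 0" by (metis add_cancel_left_left cinner_add_left)
      ultimately show ?thesis by metis
    qed
    then show "A (X x) \<in> range A \<and> (\<forall>v\<in>range A. cinner (x - A (X x)) v = 0)" by auto
    fix p assume p: "p \<in> range A \<and> (\<forall>v\<in>range A. cinner (x - p) v = 0)"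
    have "p - A (X x) \<in> range A" using p lin(2) by (metis imageE rangeI)
    then have "inner (x - p) (p - A (X x)) = 0" "inner (x - A (X x)) (p - A (X x)) = 0"
      using p orth by (auto simp: Re_cinner[symmetric])
    then have "inner (p - A (X x)) (p - A (X x)) = 0"
      by (simp add: inner_diff_left)
    then show "p = A (X x)" by simp
  qed
  have eq: "mp_inverse A = X"
    unfolding mp_inverse_def adj
  proof (rule the_equality)
    show "bounded_clinear X \<and> A \<circ> X \<circ> A = A \<and> X \<circ> A \<circ> X = X
        \<and> A \<circ> X = orth_proj (range A) \<and> X \<circ> A = orth_proj (range A)"
      using clX X AX by (auto simp: proj fun_eq_iff)
    fix Y assume Y: "bounded_clinear Y \<and> A \<circ> Y \<circ> A = A \<and> Y \<circ> A \<circ> Y = Y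
        \<and> A \<circ> Y = orth_proj (range A) \<and> Y \<circ> A = orth_proj (range A)"
    have AY: "A (Y x) = A (X x)" "Y (A x) = X (A x)" for x
      using Y proj AX by (metis comp_apply)+
    show "Y = X"
    proof
      fix x
      have "Y x = Y (A (Y x))" using Y by (metis comp_apply)
      also have "\<dots> = X (A (X x))" by (simp add: AY)
      finally show "Y x = X x" by (simp add: X(3))
    qed
  qed
  show "symmetric_op (mp_inverse A)" "A (mp_inverse A (A x)) = A x"
    "mp_inverse A (A (mp_inverse A x)) = mp_inverse A x"
    using X by (simp_all add: eq)
  show "D (mp_inverse A x) = mp_inverse A (D x)" if "linear D" "\<And>x. D (A x) = A (D x)"
    using comm[rule_format, OF that] by (simp add: eq)
qed

section \<open>Comparison of the sums of ranges\<close>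

lemma form_range_sum_mono:
  fixes P Q P' Q' :: "'a::{real_inner,banach} \<Rightarrow> 'a"
  assumes "nonneg_op P" "nonneg_op Q" "nonneg_op P'" "nonneg_op Q'"
    and "\<And>x. inner (P x) x + inner (Q x) x \<le> inner (P' x) x + inner (Q' x) x"
  shows "form_range P + form_range Q \<subseteq> form_range P' + form_range Q'"
  unfolding form_range_add[OF assms(1,2), symmetric] form_range_add[OF assms(3,4), symmetric]
  by (rule form_range_mono[OF nonneg_op_add[OF assms(1,2)]])
    (use assms(5) in \<open>simp add: inner_add_left\<close>)

text \<open>X = X A X splits along the parts of \<open>A\<close>. Conjugation by \<open>X\<close>
  keeps their ranges: X A is the identity on \<open>range A\<close>, which contains both ranges, and
  \<open>A\<close> acts on the range of each part as that part up to sign.\<close>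

lemma mp_inverse_conjugate_parts:
  assumes A: "bounded_clinear A" "symmetric_op A" "splits A"
  defines "X \<equiv> mp_inverse A"
  shows "nonneg_op (\<lambda>x. X (pos_part A (X x)))" and "nonneg_op (\<lambda>x. X (neg_part A (X x)))"
    and "form_range (\<lambda>x. X (pos_part A (X x))) = range (pos_part A)"
    and "form_range (\<lambda>x. X (neg_part A (X x))) = range (neg_part A)"
    and "inner (X x) x = inner (X (pos_part A (X x))) x - inner (X (neg_part A (X x))) x"
proof -
  note pos = pos_part_properties[OF A] and neg = neg_part_properties[OF A]
  note X = mp_inverse_properties[OF A, folded X_def]
  have symX: "symmetric_op X" by (rule X)
  note linX = linear_simps_op[OF symmetric_opD(1)[OF symX]]
  note blA = bounded_clinearD(1)[OF A(1)]
  have XA: "A (X x) = X (A x)" for x by (rule X(4)[OF bounded_linear.linear[OF blA]]) (rule refl)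
  have comm: "pos_part A (X x) = X (pos_part A x)" "neg_part A (X x) = X (neg_part A x)" for x
    by (rule pos(7)[OF symmetric_opD(1)[OF symX], symmetric], simp add: XA)
      (rule neg(7)[OF symmetric_opD(1)[OF symX], symmetric], simp add: XA)
  have XAA: "X (A (A y)) = A y" for y using X(2) XA by metis
  have inv1: "\<exists>w. pos_part A y = X (pos_part A (pos_part A w))" for y
  proof -
    obtain w where "pos_part A y = A w" using pos(4) by blast
    then have "pos_part A y = X (A (pos_part A y))" by (simp add: XAA)
    then show ?thesis by (auto simp: pos(6))
  qed
  have inv2: "\<exists>w. neg_part A y = X (neg_part A (neg_part A w))" for y
  proof -
    note lin = linear_simps_op[OF bounded_clinearD(1)[OF neg(1)]]
    obtain w where "neg_part A y = A w" using neg(4) by blast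
    then have "neg_part A y = X (A (neg_part A y))" by (simp add: XAA)
    \<comment> \<open>\<open>A\<close> acts on the range of its negative part as minus that part;
      the witness \<open>- y\<close> absorbs the sign.\<close>
    then have "neg_part A y = X (neg_part A (neg_part A (- y)))" by (simp add: neg(6) lin)
    then show ?thesis by blast
  qed
  show "nonneg_op (\<lambda>x. X (pos_part A (X x)))" "nonneg_op (\<lambda>x. X (neg_part A (X x)))"
    by (rule conjugate_nonneg_op[OF symX pos(2)], rule conjugate_nonneg_op[OF symX neg(2)])
  show "form_range (\<lambda>x. X (pos_part A (X x))) = range (pos_part A)"
    by (rule form_range_conjugate[OF symX pos(2,3) comm(1) inv1])
  show "form_range (\<lambda>x. X (neg_part A (X x))) = range (neg_part A)"
    by (rule form_range_conjugate[OF symX neg(2,3) comm(2) inv2])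
  have "X x = X (pos_part A (X x)) - X (neg_part A (X x))"
    unfolding linX(2)[symmetric] pos_part_minus_neg_part by (simp add: X(3))
  then show "inner (X x) x = inner (X (pos_part A (X x))) x - inner (X (neg_part A (X x))) x"
    unfolding inner_diff_left[symmetric] by (rule arg_cong)
qed

theorem theorem4p10:
  fixes S T :: "'a::complex_hilbert_space \<Rightarrow> 'a"
  assumes "bounded_clinear S" and "bounded_clinear T"
    and "selfadjoint S" and "selfadjoint T"
    and "closed (range S)" and "closed (range T)"
    and "S \<le>\<^sub>L T" and "mp_inverse T \<le>\<^sub>L mp_inverse S"
  shows "range (sqrt_op (\<lambda>x. pos_part T x + neg_part S x)) =
           range (sqrt_op (\<lambda>x. pos_part S x + neg_part T x)) \<and>
         range (sqrt_op (\<lambda>x. pos_part S x + neg_part T x)) = range S + range T \<and>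
         range (pos_part T) + range (neg_part S) = range (pos_part S) + range (neg_part T) \<and>
         range (pos_part S) + range (neg_part T) = range S + range T \<and>
         (nullspace T \<subseteq> nullspace (neg_part S) \<and> nullspace S \<subseteq> nullspace (neg_part T)
            \<longrightarrow> range S = range T)"
proof -
  have sym: "symmetric_op S" "symmetric_op T"
    using assms by (simp_all add: selfadjoint_iff_symmetric)
  then have spl: "splits S" "splits T" using assms by (simp_all add: closed_range_splits)
  note S = assms(1) sym(1) spl(1) and T = assms(2) sym(2) spl(2)
  note posS = pos_part_properties[OF S] and negS = neg_part_properties[OF S]
  note posT = pos_part_properties[OF T] and negT = neg_part_properties[OF T]
  note fr = form_range_nonneg_eq_range[OF posS(2,3)] form_range_nonneg_eq_range[OF negS(2,3)]
    form_range_nonneg_eq_range[OF posT(2,3)] form_range_nonneg_eq_range[OF negT(2,3)]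
  have dec: "inner (S x) x = inner (pos_part S x) x - inner (neg_part S x) x"
    "inner (T x) x = inner (pos_part T x) x - inner (neg_part T x) x" for x
    by (simp_all add: inner_diff_left[symmetric] pos_part_minus_neg_part)
  have "inner (pos_part S x) x + inner (neg_part T x) x
      \<le> inner (pos_part T x) x + inner (neg_part S x) x" for x
  proof -
    have "inner (S x) x \<le> inner (T x) x" using assms(7) by (simp add: loewner_le_def Re_cinner)
    then show ?thesis using dec[of x] by linarith
  qed
  then have le: "range (pos_part S) + range (neg_part T) \<subseteq> range (pos_part T) + range (neg_part S)"
    using form_range_sum_mono[OF posS(2) negT(2) posT(2) negS(2)] by (simp add: fr)
  note cS = mp_inverse_conjugate_parts[OF S] and cT = mp_inverse_conjugate_parts[OF T]
  have "inner (mp_inverse T x) x \<le> inner (mp_inverse S x) x" for x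
    using assms(8) by (simp add: loewner_le_def Re_cinner)
  \<comment> \<open>With X and Y the inverses of \<open>T\<close> and \<open>S\<close>, the
    assumption rearranges to X T^+ X + Y S^- Y <= Y S^+ Y + X T^- X, and each conjugated part has
    the range of the part itself.\<close>
  then have "range (pos_part T) + range (neg_part S) \<subseteq> range (pos_part S) + range (neg_part T)"
    using form_range_sum_mono[OF cT(1) cS(2) cS(1) cT(2)]
    unfolding cS(3,4,5) cT(3,4,5) by (simp add: algebra_simps)
  with le have eq: "range (pos_part T) + range (neg_part S) = range (pos_part S) + range (neg_part T)"
    by blast
  have sub: "subspace (range A)" if "bounded_clinear A" for A :: "'a \<Rightarrow> 'a"
    using bounded_linear.linear[OF bounded_clinearD(1)[OF that]]
    by (intro linear_subspace_image) auto
  define W where "W = range (pos_part S) + range (neg_part T)"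
  have W: "subspace W"
  proof -
    have "W = {x + y |x y. x \<in> range (pos_part S) \<and> y \<in> range (neg_part T)}"
      unfolding W_def set_plus_def by blast
    then show ?thesis using subspace_sums[OF sub[OF posS(1)] sub[OF negT(1)]] by simp
  qed
  \<comment> \<open>By \<open>eq\<close>, \<open>W\<close> is both sums at once, so it contains the
    ranges of all four parts and therefore those of \<open>S\<close> and \<open>T\<close>.\<close>
  have memW: "pos_part S x \<in> W" "neg_part S x \<in> W" "pos_part T x \<in> W" "neg_part T x \<in> W" for x
  proof -
    have 0: "0 \<in> range A" if "bounded_clinear A" for A :: "'a \<Rightarrow> 'a"
      using sub[OF that] by (rule subspace_0)
    show "pos_part S x \<in> W" "neg_part T x \<in> W"
      unfolding W_def
      using set_plus_intro[OF rangeI 0[OF negT(1)], of "pos_part S" x]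
        set_plus_intro[OF 0[OF posS(1)] rangeI, of "neg_part T" x] by simp_all
    show "pos_part T x \<in> W" "neg_part S x \<in> W"
      unfolding W_def eq[symmetric]
      using set_plus_intro[OF rangeI 0[OF negS(1)], of "pos_part T" x]
        set_plus_intro[OF 0[OF posT(1)] rangeI, of "neg_part S" x] by simp_all
  qed
  have "S x \<in> W" "T x \<in> W" for x
    using subspace_diff[OF W memW(1,2)[of x]] subspace_diff[OF W memW(3,4)[of x]]
    by (simp_all add: pos_part_minus_neg_part)
  then have "range S + range T \<subseteq> W"
    by (auto elim!: set_plus_elim intro: subspace_add[OF W])
  moreover have "W \<subseteq> range S + range T"
    unfolding W_def by (rule set_plus_mono2[OF posS(4) negT(4)])
  ultimately have Weq: "W = range S + range T" by blast
  have cl_add: "bounded_clinear (\<lambda>x. A x + B x)" if "bounded_clinear A" "bounded_clinear B"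
    for A B :: "'a \<Rightarrow> 'a"
    using that by (simp add: bounded_clinear_def bounded_linear_add scaleC_add_right)
  \<comment> \<open>The range of the root of a sum is the sum of the form ranges, and each part has
    form range equal to its range because it splits.\<close>
  have sq: "range (sqrt_op (\<lambda>x. pos_part T x + neg_part S x)) = range (pos_part T) + range (neg_part S)"
    "range (sqrt_op (\<lambda>x. pos_part S x + neg_part T x)) = range (pos_part S) + range (neg_part T)"
    by (simp_all add: range_sqrt_op cl_add nonneg_op_add form_range_add fr
        posS(1,2) negS(1,2) posT(1,2) negT(1,2))
  have "range S = range T"
    if N: "nullspace T \<subseteq> nullspace (neg_part S)" "nullspace S \<subseteq> nullspace (neg_part T)"
  proof -
    have incl: "range N \<subseteq> range A"
      if "symmetric_op A" "splits A" "nonneg_op N" "nullspace A \<subseteq> nullspace N" for A N :: "'a \<Rightarrow> 'a"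
      using that symmetric_opD(2)[OF nonneg_opD(1)[OF that(3)]]
      by (auto intro!: symmetric_range_memI simp: nullspace_def)
    have closed_sum: "U + V \<subseteq> range A"
      if "bounded_clinear A" "U \<subseteq> range A" "V \<subseteq> range A" for U V and A :: "'a \<Rightarrow> 'a"
      using that by (auto elim!: set_plus_elim intro!: subspace_add[OF sub])
    \<comment> \<open>Kernel inclusions dualise to range inclusions. Each description of
      \<open>W\<close> involves a positive part of one operator and a negative part of the other, so
      one description places \<open>W\<close> in \<open>range T\<close> and the other in
      \<open>range S\<close>.\<close>
    have "W \<subseteq> range T"
      unfolding W_def eq[symmetric] using posT(4) incl[OF sym(2) spl(2) negS(2) N(1)]
      by (rule closed_sum[OF T(1)])
    moreover have "W \<subseteq> range S"
      unfolding W_def using posS(4) incl[OF sym(1) spl(1) negT(2) N(2)]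
      by (rule closed_sum[OF S(1)])
    ultimately show ?thesis using \<open>\<And>x. S x \<in> W\<close> \<open>\<And>x. T x \<in> W\<close> by blast
  qed
  then show ?thesis using sq eq Weq W_def by blast
qed

end
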